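(* Let $p$ be a prime and let $G$ be a finitely generated group. Then $G/Z(G)\simeq C_p\times C_p$ if and only if $G$ can be written in the form $G = D\times A$, where $A$ is a finitely generated abelian group and $D$ is an indecomposable group such that $D=\langle x,y,Z(D)\rangle$ for some elements $x,y\in D$, where $Z(D)$ is of the form $Z(D)=\langle t_1\rangle\times\langle z_2\rangle\times\langle z_3\rangle$ with: (i) $o(t_1)=p^{m_1}$ with $m_1\geq 1$, and $[x,y]=x^{-1}y^{-1}xy=t_1^{p^{m_1-1}}$; (ii) for each $i=2,3$, either $o(z_i)=p^{m_i}$ with $m_i\geq 0$, or $o(z_i)=\infty$; (iii) $x^p,y^p\in Z(D)$, with $x^p\in\langle t_1\rangle\times\langle z_2\rangle$.
   Context: $Z(X)$ denotes the center of a group $X$; $C_p$ denotes a cyclic group of order $p$; $o(g)$ denotes the order of an element $g$. A group is indecomposable if it is not a direct product of two nontrivial subgroups. Direct products of subgroups are internal direct products. *)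

theory Defs
  imports
    "HOL-Algebra.Elementary_Groups"
    "HOL-Algebra.Generated_Groups"
    "HOL-Algebra.Multiplicative_Group"
    "HOL-Computational_Algebra.Primes"
begin

text \<open>A subgroup \<open>H\<close> of \<open>G\<close> is turned into a group as \<open>G\<lparr>carrier := H\<rparr>\<close>.\<close>

definition group_center :: "('a, 'b) monoid_scheme \<Rightarrow> 'a set"
  where "group_center G =
    {z \<in> carrier G. \<forall>g \<in> carrier G. z \<otimes>\<^bsub>G\<^esub> g = g \<otimes>\<^bsub>G\<^esub> z}"

definition finitely_generated_group :: "('a, 'b) monoid_scheme \<Rightarrow> bool"
  where "finitely_generated_group G \<longleftrightarrow>
    group G \<and> (\<exists>S. finite S \<and> S \<subseteq> carrier G \<and> generate G S = carrier G)"

definition internal_direct_product :: "('a, 'b) monoid_scheme \<Rightarrow> 'a set \<Rightarrow> 'a set \<Rightarrow> bool"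
  where "internal_direct_product G H K \<longleftrightarrow>
    H \<lhd> G \<and> K \<lhd> G \<and> H \<inter> K = {\<one>\<^bsub>G\<^esub>} \<and> H <#>\<^bsub>G\<^esub> K = carrier G"

definition indecomposable_group :: "('a, 'b) monoid_scheme \<Rightarrow> bool"
  where "indecomposable_group G \<longleftrightarrow>
    group G \<and>
    (\<forall>H K. internal_direct_product G H K \<longrightarrow> H = {\<one>\<^bsub>G\<^esub>} \<or> K = {\<one>\<^bsub>G\<^esub>})"

text \<open>\<open>G = \<langle>a\<rangle> \<times> \<langle>b\<rangle> \<times> \<langle>c\<rangle>\<close>, bracketed as \<open>(\<langle>a\<rangle> \<times> \<langle>b\<rangle>) \<times> \<langle>c\<rangle>\<close>; the subgroup
  \<open>\<langle>a\<rangle> \<times> \<langle>b\<rangle>\<close> is the product set \<open>\<langle>a\<rangle> <#> \<langle>b\<rangle>\<close>.\<close>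

definition direct_product_of_three_cyclic ::
    "('a, 'b) monoid_scheme \<Rightarrow> 'a \<Rightarrow> 'a \<Rightarrow> 'a \<Rightarrow> bool"
  where "direct_product_of_three_cyclic G a b c \<longleftrightarrow>
    a \<in> carrier G \<and> b \<in> carrier G \<and> c \<in> carrier G \<and>
    internal_direct_product (G\<lparr>carrier := generate G {a} <#>\<^bsub>G\<^esub> generate G {b}\<rparr>)
      (generate G {a}) (generate G {b}) \<and>
    internal_direct_product G
      (generate G {a} <#>\<^bsub>G\<^esub> generate G {b}) (generate G {c})"

text \<open>\<open>group.ord G z = 0\<close> expresses that \<open>z\<close> has infinite order.\<close>

definition p_power_or_infinite_order :: "('a, 'b) monoid_scheme \<Rightarrow> nat \<Rightarrow> 'a \<Rightarrow> bool"
  where "p_power_or_infinite_order G p z \<longleftrightarrow>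
    (\<exists>m::nat. group.ord G z = p ^ m) \<or> group.ord G z = 0"

end

theory Submission
  imports Defs "HOL-Algebra.Zassenhaus"
begin

text \<open>
  The quotient by the center is \<open>C\<^sub>p \<times> C\<^sub>p\<close> exactly when there are \<open>x\<close>, \<open>y\<close> with central \<open>p\<close>-th powers
  and a nontrivial central commutator \<open>c\<close> such that every element is \<open>x\<^sup>i y\<^sup>j z\<close> with \<open>z\<close> central; two
  elements commute iff the determinant of their exponents vanishes modulo \<open>p\<close>. Hence two commuting
  subgroups cannot both be nonabelian, and a complement of a maximal central direct factor (which
  exists because the center is finitely generated abelian) is indecomposable.

  If \<open>G\<close> itself is indecomposable, split its center \<open>Z\<close> three times: first \<open>Z = \<langle>t\<rangle> \<times> R\<^sub>1\<close>, where a
  suitable power of \<open>t\<close> is \<open>c\<close>; then, modulo \<open>p\<close>-th powers, the \<open>R\<^sub>1\<close>-part of \<open>x\<^sup>p\<close> lies in a cyclic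
  factor \<open>\<langle>z\<^sub>2\<rangle>\<close> of \<open>R\<^sub>1 = \<langle>z\<^sub>2\<rangle> \<times> R\<^sub>2\<close>, and the \<open>R\<^sub>2\<close>-part of \<open>y\<^sup>p\<close> in a cyclic factor \<open>\<langle>z\<^sub>3\<rangle>\<close> of
  \<open>R\<^sub>2 = \<langle>z\<^sub>3\<rangle> \<times> R\<^sub>3\<close>. Multiplying \<open>x\<close> and \<open>y\<close> by central elements removes the \<open>p\<close>-th powers, so \<open>R\<^sub>3\<close> is
  a direct factor of \<open>G\<close> and must be trivial.
\<close>

text \<open>Three cyclic factors appear because three central elements have to be accommodated:
  \<open>c\<close>, \<open>x^p\<close> and \<open>y^p\<close>. Each factor is sought in the
  complement of the earlier ones, whence the asymmetry: \<open>y^p\<close> may keep components in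
  all three factors, while \<open>x^p\<close> has none in the third. The obstacle is that a given
  decomposition of the center spreads such an element over many cyclic factors, so the decomposition
  must be adapted to the element. This rests on the orders \<open>p^m\<close> and infinity being
  linearly ordered by divisibility, infinity counting as 0: of two factors, one can always be
  altered by the other. The direction differs. The components of \<open>c\<close> have order
  dividing \<open>p\<close>, and for \<open>c\<close> to become a \<open>p^m\<close>-th power of a
  generator the factor of smaller order takes over, extended by a root taken in the other. For
  \<open>x^p\<close> and \<open>y^p\<close> only the class modulo \<open>p\<close>-th powers
  matters, and the factor of larger order takes over, since its generator may be multiplied by any
  element of the other.\<close>

section \<open>Finitely generated abelian groups\<close>

text \<open>Elementwise form of the internal direct product \<open>R = \<langle>u\<rangle> \<times> R'\<close>.\<close>

definition splits :: "('a, 'b) monoid_scheme \<Rightarrow> 'a set \<Rightarrow> 'a \<Rightarrow> 'a set \<Rightarrow> bool"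
  where "splits G R u R' \<longleftrightarrow> subgroup R' G \<and> u \<in> carrier G \<and>
    (\<forall>k::int. u [^]\<^bsub>G\<^esub> k \<in> R' \<longrightarrow> u [^]\<^bsub>G\<^esub> k = \<one>\<^bsub>G\<^esub>) \<and>
    R = {u [^]\<^bsub>G\<^esub> k \<otimes>\<^bsub>G\<^esub> r | (k::int) r. r \<in> R'}"

text \<open>Cyclic factors of order prime to \<open>p\<close> need no refinement, since all their elements are \<open>p\<close>-th
  powers. An element of infinite order has \<open>ord u = 0\<close>, which is not coprime to a prime \<open>p\<close>.\<close>

inductive primary_sum :: "('a, 'b) monoid_scheme \<Rightarrow> nat \<Rightarrow> 'a set \<Rightarrow> bool"
  for G p where
    trivial: "primary_sum G p {\<one>\<^bsub>G\<^esub>}"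
  | split: "splits G R u R' \<Longrightarrow> primary_sum G p R' \<Longrightarrow>
      p_power_or_infinite_order G p u \<or> coprime (group.ord G u) p \<Longrightarrow> primary_sum G p R"

section \<open>Manipulating cyclic direct factors\<close>

context comm_group
begin

lemma mult_inv_cancel: "a \<in> carrier G \<Longrightarrow> b \<in> carrier G \<Longrightarrow> a \<otimes> b \<otimes> inv a = b"
  by (simp add: m_assoc m_comm[of a] r_inv)

lemma cyclic_mult_subgroup:
  assumes "u \<in> carrier G" "subgroup H G"
  shows "subgroup {u [^] (k::int) \<otimes> r | k r. r \<in> H} G" (is "subgroup ?S G")
proof
  note H = subgroup.mem_carrier[OF assms(2)]
  show "?S \<subseteq> carrier G" using assms(1) H by auto
  show "\<one> \<in> ?S" using assms(1) subgroup.one_closed[OF assms(2)]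
    by (auto intro!: exI[of _ "0::int"] exI[of _ "\<one>"])
  fix a assume "a \<in> ?S"
  then obtain k r where a: "a = u [^] (k::int) \<otimes> r" "r \<in> H" by auto
  have "inv a = u [^] (-k) \<otimes> inv r"
    using a H[OF a(2)] assms(1) by (simp add: int_pow_neg inv_mult)
  then show "inv a \<in> ?S" using subgroup.m_inv_closed[OF assms(2) a(2)] by blast
  fix b assume "b \<in> ?S"
  then obtain l s where b: "b = u [^] (l::int) \<otimes> s" "s \<in> H" by auto
  have "a \<otimes> b = u [^] (k + l) \<otimes> (r \<otimes> s)"
    using a b H[OF a(2)] H[OF b(2)] assms(1) by (simp add: int_pow_mult m_ac)
  then show "a \<otimes> b \<in> ?S" using subgroup.m_closed[OF assms(2) a(2) b(2)] by blast
qed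

lemma splitsD:
  assumes "splits G R u R'"
  shows "subgroup R' G" "subgroup R G" "u \<in> carrier G" "u \<in> R" "R' \<subseteq> R"
    "\<And>k::int. u [^] k \<in> R' \<Longrightarrow> u [^] k = \<one>"
    "R = {u [^] (k::int) \<otimes> r | k r. r \<in> R'}"
proof -
  show 1: "subgroup R' G" and 2: "u \<in> carrier G"
    and 3: "\<And>k::int. u [^] k \<in> R' \<Longrightarrow> u [^] k = \<one>"
    and 4: "R = {u [^] (k::int) \<otimes> r | k r. r \<in> R'}"
    using assms unfolding splits_def by auto
  show "subgroup R G" using cyclic_mult_subgroup[OF 2 1] 4 by simp
  have "u = u [^] (1::int) \<otimes> \<one>" using 2 by simp
  then show "u \<in> R" unfolding 4 using subgroup.one_closed[OF 1] by blast
  show "R' \<subseteq> R"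
  proof
    fix r assume r: "r \<in> R'"
    have "r = u [^] (0::int) \<otimes> r" using subgroup.mem_carrier[OF 1 r] by simp
    then show "r \<in> R" unfolding 4 using r by blast
  qed
qed

text \<open>Direct products commute. An induction produces a suitable factor \<open>z\<close> only
  inside the complement of \<open>u\<close>; this brings \<open>z\<close> to the front and keeps
  \<open>u\<close> as a factor of the new complement, so that the complement is still a
  \<open>primary_sum\<close>.\<close>

lemma splits_swap:
  assumes "splits G R u R\<^sub>1" "splits G R\<^sub>1 z R\<^sub>2"
  shows "\<exists>R\<^sub>3. splits G R z R\<^sub>3 \<and> splits G R\<^sub>3 u R\<^sub>2"
proof (intro exI conjI)
  note A = splitsD[OF assms(1)] and B = splitsD[OF assms(2)]
  note C = subgroup.mem_carrier[OF B(1)]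
  let ?R = "{u [^] (k::int) \<otimes> r | k r. r \<in> R\<^sub>2}"
  show "splits G ?R u R\<^sub>2" unfolding splits_def
    using A(3) A(6) B(1) B(5) by (intro conjI allI impI refl) auto
  show "splits G R z ?R" unfolding splits_def
  proof (intro conjI allI impI)
    show "subgroup ?R G" by (rule cyclic_mult_subgroup[OF A(3) B(1)])
    show "z \<in> carrier G" by (rule B(3))
    show "z [^] k = \<one>" if z: "z [^] k \<in> ?R" for k :: int
    proof -
      obtain l r where l: "z [^] k = u [^] (l::int) \<otimes> r" "r \<in> R\<^sub>2" using z by auto
      then have "u [^] l = z [^] k \<otimes> inv r"
        using A(3) B(3) C[OF l(2)] by (simp add: m_assoc)
      also have "\<dots> \<in> R\<^sub>1" using l(2) B
        by (meson subgroup.m_closed subgroup.m_inv_closed subgroup_int_pow_closed subsetD)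
      finally have "u [^] l = \<one>" by (rule A(6))
      then have "z [^] k = r" using l C by simp
      then show ?thesis using l(2) B(6) by metis
    qed
    show "R = {z [^] (k::int) \<otimes> r | k r. r \<in> ?R}" (is "_ = ?T")
    proof (intro equalityI subsetI)
      fix a assume "a \<in> R"
      then obtain k s where "a = u [^] (k::int) \<otimes> s" "s \<in> R\<^sub>1" using A(7) by auto
      moreover then obtain l r where "s = z [^] (l::int) \<otimes> r" "r \<in> R\<^sub>2" using B(7) by auto
      ultimately have "a = z [^] l \<otimes> (u [^] k \<otimes> r)" "r \<in> R\<^sub>2"
        using A(3) B(3) C by (simp_all add: m_ac)
      then show "a \<in> ?T" by blast
    next
      fix a assume "a \<in> ?T"
      then obtain k l r where "a = z [^] (l::int) \<otimes> (u [^] (k::int) \<otimes> r)" and r: "r \<in> R\<^sub>2" by auto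
      then have "a = u [^] k \<otimes> (z [^] l \<otimes> r)" using A(3) B(3) C[OF r] by (simp add: m_ac)
      moreover have "z [^] l \<otimes> r \<in> R\<^sub>1" using B(7) r by blast
      ultimately show "a \<in> R" using A(7) by blast
    qed
  qed
qed

text \<open>Sending \<open>u\<close> to \<open>r\<close> is well defined on the cyclic group of
  \<open>u\<close>, and \<open>e\<close> is a unit modulo its order, so replacing \<open>u\<close>
  by the new generator is an automorphism of \<open>R\<close> that fixes \<open>R'\<close>. For
  \<open>u\<close> of infinite order, where \<open>ord u = 0\<close>, the hypotheses read
  \<open>e = 1\<close> or \<open>e = -1\<close>, with \<open>r\<close> arbitrary.\<close>

lemma splits_replace:
  assumes "splits G R u R'" "r \<in> R'" "coprime e (int (ord u))" "r [^] ord u = \<one>"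
  shows "splits G R (u [^] e \<otimes> r) R'" "ord (u [^] e \<otimes> r) = ord u"
proof -
  let ?t = "u [^] e \<otimes> r"
  note A = splitsD[OF assms(1)]
  have r: "r \<in> carrier G" and t: "?t \<in> carrier G"
    using subgroup.mem_carrier[OF A(1) assms(2)] A(3) by auto
  have tk: "?t [^] k = u [^] (e * k) \<otimes> r [^] k" for k :: int
    using r A(3) by (simp add: int_pow_distrib int_pow_pow)
  have rk: "r [^] k \<in> R'" for k :: int
    using A(1) assms(2) by (rule subgroup_int_pow_closed)
  have zero: "?t [^] k = \<one>" if "int (ord u) dvd k" for k :: int
  proof -
    have "r [^] k = \<one>" using that assms(4) r
      by (metis dvd_def int_pow_pow int_pow_int int_pow_one)
    moreover have "u [^] (e * k) = \<one>" using that A(3) by (simp add: int_pow_eq_id)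
    ultimately show ?thesis by (simp add: tk)
  qed
  \<comment> \<open>Directness gives only that \<open>ord u\<close> divides \<open>e * k\<close>;
    coprimality cancels \<open>e\<close>.\<close>
  have dvd: "int (ord u) dvd k" if "?t [^] k \<in> R'" for k :: int
  proof -
    have "u [^] (e * k) = ?t [^] k \<otimes> inv (r [^] k)"
      using r A(3) by (simp add: tk m_assoc)
    then have "u [^] (e * k) \<in> R'" using that rk A(1)
      by (simp add: subgroup.m_closed subgroup.m_inv_closed)
    then have "u [^] (e * k) = \<one>" by (rule A(6))
    then have "int (ord u) dvd e * k" using A(3) by (simp add: int_pow_eq_id)
    then show ?thesis using assms(3) by (simp add: coprime_commute coprime_dvd_mult_right_iff)
  qed
  have eq: "?t [^] k = \<one> \<longleftrightarrow> int (ord u) dvd k" for k :: int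
    using zero dvd subgroup.one_closed[OF A(1)] by metis
  show "ord ?t = ord u"
    using eq t int_pow_eq_id[OF t] by (metis dvd_antisym dvd_refl int_dvd_int_iff)
  show "splits G R ?t R'" unfolding splits_def
  proof (intro conjI allI impI A(1) t)
    show "?t [^] k = \<one>" if "?t [^] k \<in> R'" for k :: int using zero dvd that by blast
    show "R = {?t [^] (k::int) \<otimes> s | k s. s \<in> R'}" (is "_ = ?S")
    proof (intro equalityI subsetI)
      fix a assume "a \<in> R"
      then obtain k s where a: "a = u [^] (k::int) \<otimes> s" and s: "s \<in> R'" using A(7) by auto
      \<comment> \<open>The inverse \<open>i\<close> of \<open>e\<close> modulo \<open>ord u\<close>
        expresses \<open>u^k\<close> through the new generator, up to an element of
        \<open>R'\<close>.\<close>
      obtain i j where ij: "e * i + int (ord u) * j = 1"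
        using assms(3) bezout_int[of e "int (ord u)"] by (auto simp: mult.commute)
      have "k = e * (i * k) + int (ord u) * (j * k)"
        using arg_cong[OF ij, of "\<lambda>x. x * k"] by (simp add: algebra_simps)
      then have "u [^] k = u [^] (e * (i * k)) \<otimes> u [^] (int (ord u) * (j * k))"
        using A(3) by (metis int_pow_mult)
      also have "u [^] (int (ord u) * (j * k)) = \<one>" using A(3) by (simp add: int_pow_eq_id)
      finally have "a = ?t [^] (i * k) \<otimes> (inv (r [^] (i * k)) \<otimes> s)"
        using a A(3) r subgroup.mem_carrier[OF A(1) s]
        by (simp add: tk m_assoc) (simp flip: m_assoc)
      moreover have "inv (r [^] (i * k)) \<otimes> s \<in> R'"
        using rk s A(1) by (simp add: subgroup.m_closed subgroup.m_inv_closed)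
      ultimately show "a \<in> ?S" by blast
    next
      fix a assume "a \<in> ?S"
      then obtain k s where a: "a = ?t [^] (k::int) \<otimes> s" and s: "s \<in> R'" by auto
      then have "a = u [^] (e * k) \<otimes> (r [^] k \<otimes> s)"
        using A(3) r subgroup.mem_carrier[OF A(1) s] by (simp add: tk m_assoc)
      then show "a \<in> R" using A(7) rk s A(1) by (blast intro: subgroup.m_closed)
    qed
  qed
qed

lemma primary_sum_splits:
  assumes "prime p" "splits G R u R'" "primary_sum G p R'"
  shows "primary_sum G p R"
proof (cases "ord u = 0")
  case True
  then show ?thesis using assms by (auto intro: primary_sum.split simp: p_power_or_infinite_order_def)
next
  case False
  note A = splitsD[OF assms(2)]
  obtain s a where s: "ord u = p ^ a * s" "\<not> p dvd s"
    using False assms(1) by (metis multiplicity_decompose' not_prime_unit zero_neq_numeral)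
  have cop: "coprime s p" "coprime (int s) (int (p ^ a))"
    using assms(1) s(2) prime_imp_coprime coprime_commute
    by (metis, metis coprime_power_right_iff coprime_int_iff prime_imp_coprime coprime_commute)
  let ?v = "u [^] s" and ?w = "u [^] (p ^ a)"
  have vk: "?v [^] k = u [^] (int s * k)" for k :: int
    using A(3) by (metis int_pow_int int_pow_pow)
  have wk: "?w [^] k = u [^] (int (p ^ a) * k)" for k :: int
    using A(3) by (metis int_pow_int int_pow_pow)
  have pos: "s > 0" "p ^ a > 0" using False s(1) by (metis mult_0_right mult_0 not_gr_zero)+
  have ordw: "ord ?w = s"
    using ord_pow[OF A(3), of "p ^ a"] s(1) pos(2) by (metis dvd_triv_left nonzero_mult_div_cancel_left not_gr_zero)
  have ordv: "ord ?v = p ^ a"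
    using ord_pow[OF A(3), of s] s(1) pos(1) by (metis dvd_triv_right nonzero_mult_div_cancel_right not_gr_zero)
  let ?S = "{?w [^] (k::int) \<otimes> r | k r. r \<in> R'}"
  have S: "splits G ?S ?w R'" unfolding splits_def
  proof (intro conjI allI impI A(1) refl)
    show "?w \<in> carrier G" using A(3) by simp
    show "?w [^] k = \<one>" if "?w [^] k \<in> R'" for k :: int
      using that A(6) unfolding wk by blast
  qed
  have "splits G R ?v ?S" unfolding splits_def
  proof (intro conjI allI impI)
    show "subgroup ?S G" using splitsD(2)[OF S] .
    show "?v \<in> carrier G" using A(3) by simp
    show "?v [^] k = \<one>" if v: "?v [^] k \<in> ?S" for k :: int
    proof -
      obtain l r where l: "?v [^] k = ?w [^] (l::int) \<otimes> r" "r \<in> R'" using v by blast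
      then have "u [^] (int s * k - int (p ^ a) * l) = r"
        using A(3) subgroup.mem_carrier[OF A(1) l(2)] unfolding vk wk
        by (simp add: int_pow_diff mult_inv_cancel)
      then have "u [^] (int s * k - int (p ^ a) * l) = \<one>" using A(6) l(2) by blast
      then have "int (ord u) dvd int s * k - int (p ^ a) * l"
        using int_pow_eq_id[OF A(3)] by blast
      then have "int (p ^ a) dvd int s * k - int (p ^ a) * l"
        using s(1) by (metis dvd_mult_left of_nat_mult)
      then have "int (p ^ a) dvd (int s * k - int (p ^ a) * l) + int (p ^ a) * l"
        by (rule dvd_add) simp
      then have "int (p ^ a) dvd int s * k" by simp
      then have "int (p ^ a) dvd k" using cop(2) coprime_commute coprime_dvd_mult_right_iff by metis
      then have "int (ord u) dvd int s * k" unfolding s(1) by (simp add: mult.commute)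
      then show ?thesis using A(3) by (simp add: vk int_pow_eq_id)
    qed
    show "R = {?v [^] (k::int) \<otimes> r | k r. r \<in> ?S}" (is "_ = ?T")
    proof (intro equalityI subsetI)
      fix b assume "b \<in> R"
      then obtain k r where b: "b = u [^] (k::int) \<otimes> r" and r: "r \<in> R'" using A(7) by auto
      obtain i j where ij: "int s * i + int (p ^ a) * j = 1"
        using cop(2) bezout_int[of "int s" "int (p ^ a)"] by (auto simp: mult.commute)
      have "k = int s * (i * k) + int (p ^ a) * (j * k)"
        using arg_cong[OF ij, of "\<lambda>x. x * k"] by (simp add: algebra_simps)
      then have "u [^] k = ?v [^] (i * k) \<otimes> ?w [^] (j * k)"
        unfolding vk wk using A(3) by (metis int_pow_mult)
      then have "b = ?v [^] (i * k) \<otimes> (?w [^] (j * k) \<otimes> r)"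
        using b A(3) subgroup.mem_carrier[OF A(1) r] by (simp add: m_assoc)
      then show "b \<in> ?T" using r by blast
    next
      fix b assume "b \<in> ?T"
      then obtain k l r where b: "b = ?v [^] (k::int) \<otimes> (?w [^] (l::int) \<otimes> r)" and r: "r \<in> R'"
        by blast
      then have "b = u [^] (int s * k + int (p ^ a) * l) \<otimes> r"
        using A(3) subgroup.mem_carrier[OF A(1) r] unfolding vk wk
        by (simp add: m_assoc int_pow_mult)
      then show "b \<in> R" using A(7) r by blast
    qed
  qed
  moreover have "primary_sum G p ?S"
    using S assms(3) ordw cop(1) by (intro primary_sum.split[OF S]) auto
  ultimately show ?thesis
    using ordv by (intro primary_sum.split[of G R ?v ?S]) (auto simp: p_power_or_infinite_order_def)
qed

section \<open>Decomposition of finitely generated abelian groups, and their subgroups\<close>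

lemma generate_insert_comm:
  assumes "u \<in> carrier G" "S \<subseteq> carrier G"
  shows "generate G (insert u S) = {u [^] (k::int) \<otimes> r | k r. r \<in> generate G S}" (is "?L = ?R")
proof
  have S: "subgroup (generate G S) G" and L: "subgroup ?L G"
    using assms by (simp_all add: generate_is_subgroup)
  have "u [^] (1::int) \<otimes> \<one> \<in> ?R" using subgroup.one_closed[OF S] by blast
  then have "u \<in> ?R" using assms(1) by simp
  moreover have "S \<subseteq> ?R"
  proof
    fix s assume s: "s \<in> S"
    have "u [^] (0::int) \<otimes> s \<in> ?R" using generate.incl[OF s] by blast
    then show "s \<in> ?R" using subsetD[OF assms(2) s] by (simp only: int_pow_0 l_one)
  qed
  ultimately show "?L \<subseteq> ?R"
    by (intro generate_subgroup_incl cyclic_mult_subgroup[OF assms(1) S] insert_subsetI)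
  have u: "u \<in> ?L" by (rule generate.incl) simp
  have "generate G S \<subseteq> ?L" by (rule mono_generate) auto
  then show "?R \<subseteq> ?L"
    by (auto intro!: subgroup.m_closed[OF L] subgroup_int_pow_closed[OF L u])
qed

lemma generate_remove:
  assumes "i \<in> I" "x \<in> I \<rightarrow> carrier G"
  shows "generate G (x ` I) = {x i [^] (k::int) \<otimes> r | k r. r \<in> generate G (x ` (I - {i}))}"
proof -
  have "x ` I = insert (x i) (x ` (I - {i}))" using assms(1) by auto
  moreover have "x i \<in> carrier G" "x ` (I - {i}) \<subseteq> carrier G" using assms by auto
  ultimately show ?thesis using generate_insert_comm by simp
qed

lemma finprod_subgroup_closed:
  assumes "subgroup H G" "f \<in> I \<rightarrow> H"
  shows "finprod G f I \<in> H"
proof (cases "finite I")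
  case True
  then show ?thesis using assms(2)
  proof induction
    case empty
    then show ?case using subgroup.one_closed[OF assms(1)] by simp
  next
    case (insert i I)
    then have "f \<in> I \<rightarrow> carrier G" "f i \<in> carrier G"
      using subgroup.mem_carrier[OF assms(1)] by blast+
    then show ?case using insert subgroup.m_closed[OF assms(1)] by simp
  qed
qed (use subgroup.one_closed[OF assms(1)] in simp)

lemma generate_image_finprod:
  assumes "finite I" "x \<in> I \<rightarrow> carrier G" "y \<in> generate G (x ` I)"
  shows "\<exists>n :: 'i \<Rightarrow> int. y = (\<Otimes>i\<in>I. x i [^] n i)"
  using assms
proof (induction arbitrary: y)
  case empty
  then show ?case by (simp add: generate_empty)
next
  case (insert i I)
  have x: "x i \<in> carrier G" "x \<in> I \<rightarrow> carrier G" using insert by auto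
  have "y \<in> {x i [^] (k::int) \<otimes> r | k r. r \<in> generate G (x ` I)}"
    using insert x generate_insert_comm[of "x i" "x ` I"] by auto
  then obtain k r where y: "y = x i [^] (k::int) \<otimes> r" "r \<in> generate G (x ` I)" by auto
  obtain n :: "'i \<Rightarrow> int" where n: "r = (\<Otimes>i\<in>I. x i [^] n i)"
    using insert.IH[OF x(2) y(2)] by auto
  let ?n = "n(i := k)"
  have "(\<Otimes>j\<in>I. x j [^] ?n j) = (\<Otimes>j\<in>I. x j [^] n j)"
    using insert x by (intro finprod_cong') auto
  then have "y = (\<Otimes>j\<in>insert i I. x j [^] ?n j)"
    using insert x y n by (subst finprod_insert) auto
  then show ?case by blast
qed

text \<open>The induction is on the size of the index set, not on that of the set of generators: a
  modified generator may coincide with another one, and an indexed family tolerates this without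
  losing count. If no generator has a positive power in the span of the others, any of them splits
  off as an infinite cyclic factor; otherwise one is modified until it splits off.\<close>

lemma primary_sum_generate_image:
  fixes I :: "nat set"
  assumes "prime p" "finite I" "x \<in> I \<rightarrow> carrier G"
  shows "primary_sum G p (generate G (x ` I))"
  using assms(2,3)
proof (induction "card I" arbitrary: I x)
  case 0
  then show ?case by (simp add: generate_empty primary_sum.trivial)
next
  case (Suc n)
  let ?R = "generate G (x ` I)"
  \<comment> \<open>exponents of \<open>x' i\<close> in a relation between some generating family \<open>x'\<close> of the same group; a
    minimal one divides all the others, which splits off a cyclic factor\<close>
  define good where "good m \<longleftrightarrow> m > 0 \<and> (\<exists>x' i. x' \<in> I \<rightarrow> carrier G \<and> i \<in> I \<and>
      generate G (x' ` I) = ?R \<and> x' i [^] (m::nat) \<in> generate G (x' ` (I - {i})))" for m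
  have sub: "subgroup (generate G (x' ` J)) G" if "x' \<in> I \<rightarrow> carrier G" "J \<subseteq> I" for x' J
    using that by (intro generate_is_subgroup) auto
  have goodI: "good (nat \<bar>k\<bar>)"
    if "k \<noteq> 0" "x' \<in> I \<rightarrow> carrier G" "i \<in> I" "generate G (x' ` I) = ?R"
      "x' i [^] k \<in> generate G (x' ` (I - {i}))" for k :: int and x' i
  proof -
    have "x' i \<in> carrier G" using that by auto
    then have "x' i [^] \<bar>k\<bar> \<in> generate G (x' ` (I - {i}))"
      using that subgroup.m_inv_closed[OF sub[OF that(2)], of "I - {i}" "x' i [^] k"]
      by (auto simp: abs_if int_pow_neg)
    then have "x' i [^] nat \<bar>k\<bar> \<in> generate G (x' ` (I - {i}))"
      by (metis abs_ge_zero int_nat_eq int_pow_int)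
    then show ?thesis unfolding good_def using that by auto
  qed
  have step: "primary_sum G p ?R"
    if x': "x' \<in> I \<rightarrow> carrier G" and i: "i \<in> I" and gen: "generate G (x' ` I) = ?R"
      and indep: "\<And>k::int. x' i [^] k \<in> generate G (x' ` (I - {i})) \<Longrightarrow> x' i [^] k = \<one>"
    for x' i
  proof -
    have "splits G ?R (x' i) (generate G (x' ` (I - {i})))"
      unfolding splits_def using generate_remove[OF i x'] gen indep x' i sub[OF x', of "I - {i}"]
      by auto
    moreover have "primary_sum G p (generate G (x' ` (I - {i})))"
      using Suc.hyps Suc.prems x' i by (intro Suc.hyps(1)) auto
    ultimately show ?thesis by (rule primary_sum_splits[OF assms(1)])
  qed
  show ?case
  proof (cases "\<exists>m. good m")
    case False
    obtain i where i: "i \<in> I" using Suc by fastforce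
    show ?thesis
    proof (rule step[OF Suc.prems(2) i refl])
      fix k :: int assume "x i [^] k \<in> generate G (x ` (I - {i}))"
      then show "x i [^] k = \<one>" using goodI[OF _ Suc.prems(2) i refl, of k] False
        by (cases "k = 0") auto
    qed
  next
    case True
    define m where "m = (LEAST m. good m)"
    have m: "good m" and least: "\<And>l. good l \<Longrightarrow> m \<le> l"
      using LeastI_ex[OF True] Least_le[of good] unfolding m_def by auto
    obtain x' i where x': "x' \<in> I \<rightarrow> carrier G" and i: "i \<in> I" and gen: "generate G (x' ` I) = ?R"
      and rel: "x' i [^] m \<in> generate G (x' ` (I - {i}))"
      using m unfolding good_def by blast
    have pos: "m > 0" using m by (simp add: good_def)
    let ?J = "I - {i}"
    have J: "finite ?J" "x' \<in> ?J \<rightarrow> carrier G" using Suc.prems x' by auto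
    obtain n :: "nat \<Rightarrow> int" where n: "x' i [^] m = (\<Otimes>j\<in>?J. x' j [^] n j)"
      using generate_image_finprod[OF J rel] by blast
    \<comment> \<open>The exponents are divided by \<open>m\<close> with remainder. The new
      generator \<open>y\<close> absorbs the quotients, so that only exponents below
      \<open>m\<close> remain in \<open>y^m\<close>.\<close>
    define w where "w = (\<Otimes>j\<in>?J. x' j [^] (n j div int m))"
    define y where "y = x' i \<otimes> inv w"
    define x'' where "x'' = x'(i := y)"
    let ?H = "generate G (x' ` ?J)"
    have H: "subgroup ?H G" by (rule sub[OF x']) auto
    have wH: "w \<in> ?H" unfolding w_def
    proof (rule finprod_subgroup_closed[OF H], rule)
      fix j assume "j \<in> ?J"
      then show "x' j [^] (n j div int m) \<in> ?H"
        by (intro subgroup_int_pow_closed[OF H] generate.incl) auto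
    qed
    have xi: "x' i \<in> carrier G" using x' i by auto
    have w: "w \<in> carrier G" using subgroup.mem_carrier[OF H wH] .
    have y: "y \<in> carrier G" using xi w by (simp add: y_def)
    have x'': "x'' \<in> I \<rightarrow> carrier G" using x' y by (auto simp: x''_def)
    have img: "x'' ` ?J = x' ` ?J" and yi: "x'' i = y" by (auto simp: x''_def)
    have gen': "generate G (x'' ` I) = ?R"
    proof -
      have 1: "generate G (x'' ` I) = {y [^] (k::int) \<otimes> r | k r. r \<in> ?H}"
        using generate_remove[OF i x''] img yi by simp
      have 2: "?R = {x' i [^] (k::int) \<otimes> r | k r. r \<in> ?H}"
        using generate_remove[OF i x'] gen by simp
      have wk: "w [^] k \<in> ?H" for k :: int by (rule subgroup_int_pow_closed[OF H wH])
      show ?thesis unfolding 1 2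
      proof (intro equalityI subsetI)
        fix a assume "a \<in> {y [^] (k::int) \<otimes> r | k r. r \<in> ?H}"
        then obtain k r where a: "a = y [^] (k::int) \<otimes> r" and r: "r \<in> ?H" by auto
        then have "a = x' i [^] k \<otimes> (inv (w [^] k) \<otimes> r)"
          using xi w subgroup.mem_carrier[OF H r]
          by (simp add: y_def int_pow_distrib int_pow_inv m_assoc)
        then show "a \<in> {x' i [^] (k::int) \<otimes> r | k r. r \<in> ?H}"
          using subgroup.m_closed[OF H subgroup.m_inv_closed[OF H wk] r] by blast
      next
        fix a assume "a \<in> {x' i [^] (k::int) \<otimes> r | k r. r \<in> ?H}"
        then obtain k r where a: "a = x' i [^] (k::int) \<otimes> r" and r: "r \<in> ?H" by auto
        then have "a = y [^] k \<otimes> (w [^] k \<otimes> r)"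
          using xi w subgroup.mem_carrier[OF H r]
          by (simp add: y_def int_pow_distrib int_pow_inv m_assoc) (simp flip: m_assoc)
        then show "a \<in> {y [^] (k::int) \<otimes> r | k r. r \<in> ?H}"
          using subgroup.m_closed[OF H wk r] by blast
      qed
    qed
    have "x' i [^] m = (\<Otimes>j\<in>?J. (x' j [^] (n j div int m)) [^] int m \<otimes> x' j [^] (n j mod int m))"
      unfolding n using J(2)
      by (intro finprod_cong') (auto simp: int_pow_pow Pi_def simp flip: int_pow_mult)
    also have "\<dots> = (\<Otimes>j\<in>?J. (x' j [^] (n j div int m)) [^] int m)
        \<otimes> (\<Otimes>j\<in>?J. x' j [^] (n j mod int m))"
      using J(2) by (intro finprod_multf) auto
    also have "(\<Otimes>j\<in>?J. (x' j [^] (n j div int m)) [^] int m) = w [^] m"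
      unfolding w_def int_pow_int using J
    proof (induction rule: finite_induct)
      case (insert j F)
      then have "x' j \<in> carrier G" "x' \<in> F \<rightarrow> carrier G" by auto
      then show ?case using insert by (simp add: pow_mult_distrib m_comm Pi_def)
    qed simp
    finally have ym: "y [^] m = (\<Otimes>j\<in>?J. x' j [^] (n j mod int m))" (is "_ = finprod G ?f ?J")
    proof -
      assume *: "x' i [^] m = w [^] m \<otimes> finprod G ?f ?J"
      have "finprod G ?f ?J \<in> carrier G" using J(2) by (intro finprod_closed) auto
      then show ?thesis using * xi w
        by (simp add: y_def pow_mult_distrib m_comm nat_pow_inv)
            (simp flip: m_assoc)
    qed
    \<comment> \<open>A nonzero remainder, with the relation solved for \<open>x' j\<close> in the
      family that now contains \<open>y\<close>, would be an exponent smaller than the minimal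
      \<open>m\<close>.\<close>
    have zero: "n j mod int m = 0" if j: "j \<in> ?J" for j
    proof (rule ccontr)
      assume nz: "n j mod int m \<noteq> 0"
      let ?K = "I - {j}"
      have K: "subgroup (generate G (x'' ` ?K)) G" by (rule sub[OF x'']) auto
      have Jj: "?J = insert j (?J - {j})" using j by auto
      have f: "?f \<in> ?J \<rightarrow> carrier G" using J(2) by auto
      have "finprod G ?f ?J = ?f j \<otimes> finprod G ?f (?J - {j})"
        by (subst Jj, subst finprod_insert) (use f j J(1) in auto)
      then have "?f j = y [^] m \<otimes> inv (finprod G ?f (?J - {j}))"
        using f j ym by (subst inv_solve_right) (auto intro!: finprod_closed)
      moreover have "finprod G ?f (?J - {j}) \<in> generate G (x'' ` ?K)"
      proof (rule finprod_subgroup_closed[OF K], rule)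
        fix l assume "l \<in> ?J - {j}"
        then have "x' l \<in> x'' ` ?K" by (auto simp: x''_def image_iff intro!: bexI[of _ l])
        then show "?f l \<in> generate G (x'' ` ?K)"
          by (intro subgroup_int_pow_closed[OF K] generate.incl)
      qed
      moreover have "y [^] m \<in> generate G (x'' ` ?K)"
      proof -
        have "y \<in> x'' ` ?K" using yi i j by (auto simp: image_iff intro!: bexI[of _ i])
        then show ?thesis by (metis K generate.incl int_pow_int subgroup_int_pow_closed)
      qed
      ultimately have "?f j \<in> generate G (x'' ` ?K)"
        using subgroup.m_closed[OF K] subgroup.m_inv_closed[OF K] by simp
      moreover have "x'' j = x' j" using j by (auto simp: x''_def)
      ultimately have "good (nat \<bar>n j mod int m\<bar>)"
        using goodI[OF nz x'' _ gen', of j] j by auto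
      moreover have "nat \<bar>n j mod int m\<bar> < m" using pos by (simp add: nat_less_iff)
      ultimately show False using least by fastforce
    qed
    have "y [^] m = \<one>" unfolding ym
      by (rule finprod_one_eqI) (simp add: zero)
    show ?thesis
    proof (rule step[OF x'' i gen'])
      fix k :: int assume "x'' i [^] k \<in> generate G (x'' ` (I - {i}))"
      then have k: "y [^] k \<in> ?H" using img yi by simp
      have "y [^] k = y [^] (int m * (k div int m)) \<otimes> y [^] (k mod int m)"
        using y by (simp flip: int_pow_mult)
      also have "y [^] (int m * (k div int m)) = \<one>"
        using y \<open>y [^] m = \<one>\<close> by (metis int_pow_int int_pow_one int_pow_pow)
      finally have eq: "y [^] k = y [^] (k mod int m)" using y by simp
      \<comment> \<open>Since \<open>y^m = 1\<close>, a power of \<open>y\<close> in the span of the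
        others reduces to an exponent below \<open>m\<close>, and minimality of \<open>m\<close>
        makes that exponent zero.\<close>
      have "k mod int m = 0"
      proof (rule ccontr)
        assume nz: "k mod int m \<noteq> 0"
        have "good (nat \<bar>k mod int m\<bar>)"
          using goodI[OF nz x'' i gen'] k eq img yi by simp
        moreover have "nat \<bar>k mod int m\<bar> < m" using pos by (simp add: nat_less_iff)
        ultimately show False using least by fastforce
      qed
      then show "x'' i [^] k = \<one>" using eq yi by simp
    qed
  qed
qed

lemma primary_sum_generate:
  assumes "prime p" "finite S" "S \<subseteq> carrier G"
  shows "primary_sum G p (generate G S)"
proof -
  obtain x :: "nat \<Rightarrow> 'a" and n where "S = x ` {i. i < n}"
    using finite_imp_nat_seg_image_inj_on[OF assms(2)] by blast
  then show ?thesis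
    using primary_sum_generate_image[OF assms(1), of "{i. i < n}" x] assms(3) by auto
qed

text \<open>As for subgroups of \<open>Z^n\<close>: the exponents of \<open>s\<close> in elements of
  \<open>H\<close> form an ideal of the integers. An element of \<open>H\<close> realizing the
  positive generator of this ideal, together with generators of the part of \<open>H\<close> inside
  \<open>generate G S\<close>, generates \<open>H\<close>; if the ideal is zero, that part is all of
  \<open>H\<close>.\<close>

lemma subgroup_finitely_generated:
  assumes "finite S" "S \<subseteq> carrier G" "subgroup H G" "H \<subseteq> generate G S"
  shows "\<exists>T. finite T \<and> T \<subseteq> H \<and> generate G T = H"
  using assms
proof (induction arbitrary: H)
  case empty
  then have "H = {\<one>}" using subgroup.one_closed by (auto simp: generate_empty)
  then show ?case by (intro exI[of _ "{}"]) (simp add: generate_empty)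
next
  case (insert s S)
  have s: "s \<in> carrier G" and S: "S \<subseteq> carrier G" using insert by auto
  let ?H = "H \<inter> generate G S"
  have GS: "subgroup (generate G S) G" by (rule generate_is_subgroup[OF S])
  have "subgroup ?H G" by (rule subgroups_Inter_pair[OF insert.prems(2) GS])
  then obtain T where T: "finite T" "T \<subseteq> ?H" "generate G T = ?H"
    using insert.IH[OF S, of ?H] by auto
  have Tc: "T \<subseteq> carrier G" using T(2) subgroup.subset[OF insert.prems(2)] by blast
  let ?P = "\<lambda>k::int. \<exists>r \<in> generate G S. s [^] k \<otimes> r \<in> H"
  have Hform: "\<exists>k r. h = s [^] (k::int) \<otimes> r \<and> r \<in> generate G S" if "h \<in> H" for h
    using insert.prems(3) generate_insert_comm[OF s S] that by blast
  have inv: "?P (-k)" if k: "?P k" for k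
  proof -
    obtain r where r: "r \<in> generate G S" "s [^] k \<otimes> r \<in> H" using k by auto
    have "inv (s [^] k \<otimes> r) = s [^] (-k) \<otimes> inv r"
      using s subgroup.mem_carrier[OF GS r(1)] by (simp add: inv_mult int_pow_neg)
    then show ?thesis
      using subgroup.m_inv_closed[OF insert.prems(2) r(2)] subgroup.m_inv_closed[OF GS r(1)] by metis
  qed
  show ?case
  proof (cases "\<exists>d>0. ?P (int d)")
    case False
    have "k = 0" if "?P k" for k
    proof (rule ccontr)
      assume "k \<noteq> 0"
      moreover have "?P (int (nat \<bar>k\<bar>))" using that inv[OF that] by (cases "k \<ge> 0") auto
      ultimately show False using False by (metis abs_eq_0 nat_le_0 not_gr_zero abs_ge_zero antisym nat_0_iff)
    qed
    then have "H \<subseteq> generate G S"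
      using Hform subgroup.mem_carrier[OF GS] by (metis subsetI int_pow_0 l_one)
    then show ?thesis using T by (metis Int_absorb2)
  next
    case True
    define d where "d = (LEAST d. d > 0 \<and> ?P (int d))"
    have d: "d > 0" "?P (int d)" and least: "\<And>l. l > 0 \<Longrightarrow> ?P (int l) \<Longrightarrow> d \<le> l"
      using LeastI_ex[OF True] unfolding d_def by (auto intro: Least_le)
    obtain r where r: "r \<in> generate G S" "s [^] int d \<otimes> r \<in> H" using d(2) by auto
    let ?h = "s [^] int d \<otimes> r"
    have rc: "r \<in> carrier G" using subgroup.mem_carrier[OF GS r(1)] .
    have hc: "?h \<in> carrier G" using rc s by simp
    have "H \<subseteq> generate G (insert ?h T)"
    proof
      fix a assume a: "a \<in> H"
      obtain k q where q: "a = s [^] (k::int) \<otimes> q" "q \<in> generate G S" using Hform[OF a] by blast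
      have qc: "q \<in> carrier G" using subgroup.mem_carrier[OF GS q(2)] .
      \<comment> \<open>Division by the least exponent \<open>d\<close>: the remainder must vanish,
        so \<open>?b\<close> is an element of \<open>H\<close> without a contribution of
        \<open>s\<close>.\<close>
      define e where "e = k div int d"
      let ?b = "inv (?h [^] e) \<otimes> a"
      have hH: "?h [^] l \<in> H" for l :: int by (rule subgroup_int_pow_closed[OF insert.prems(2) r(2)])
      have bH: "?b \<in> H"
        using hH a insert.prems(2) by (simp add: subgroup.m_closed subgroup.m_inv_closed)
      have "k = int d * e + k mod int d" by (simp add: e_def)
      then have "s [^] k = s [^] (int d * e) \<otimes> s [^] (k mod int d)" using s by (metis int_pow_mult)
      then have b: "?b = s [^] (k mod int d) \<otimes> (inv (r [^] e) \<otimes> q)"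
        unfolding q(1) using s rc qc
        by (simp add: int_pow_distrib int_pow_pow inv_mult m_ac)
          (simp flip: m_assoc add: m_comm)
      have rq: "inv (r [^] e) \<otimes> q \<in> generate G S"
        using subgroup_int_pow_closed[OF GS r(1)] q(2) GS
        by (simp add: subgroup.m_closed subgroup.m_inv_closed)
      have "?P (k mod int d)" using b bH rq by metis
      moreover have "k mod int d \<ge> 0" "k mod int d < int d" using d(1) by auto
      ultimately have "k mod int d = 0"
        using least[of "nat (k mod int d)"] by (cases "k mod int d = 0") auto
      then have "?b \<in> generate G T" using b bH rq T(3) subgroup.mem_carrier[OF GS rq] by simp
      moreover have "a = ?h [^] e \<otimes> ?b"
        using hc a subgroup.mem_carrier[OF insert.prems(2)] by (simp flip: m_assoc)
      ultimately show "a \<in> generate G (insert ?h T)"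
        unfolding generate_insert_comm[OF hc Tc] by blast
    qed
    moreover have "generate G (insert ?h T) \<subseteq> H"
      using r(2) T(2) insert.prems(2) by (intro generate_subgroup_incl) auto
    ultimately show ?thesis using T r(2) by (intro exI[of _ "insert ?h T"]) auto
  qed
qed

section \<open>Placing a given element in a single cyclic factor\<close>

text \<open>When \<open>u\<close> and \<open>t\<close> both contribute to \<open>c\<close>, the one of smaller order is multiplied by a power of
  the other, which puts \<open>c\<close> into a single cyclic factor.\<close>

lemma primary_sum_root_split:
  assumes "prime p" "primary_sum G p R" "c \<in> R" "c \<noteq> \<one>" "c [^] p = \<one>"
  shows "\<exists>t R' m. splits G R t R' \<and> primary_sum G p R' \<and> ord t = p ^ Suc m \<and> c = t [^] (p ^ m)"
  using assms(2-5)
proof (induction arbitrary: c rule: primary_sum.induct)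
  case trivial
  then show ?case by simp
next
  case (split R u R')
  note A = splitsD[OF split.hyps(1)]
  note C = subgroup.mem_carrier[OF A(1)]
  obtain e d where c: "c = u [^] (e::int) \<otimes> d" and d: "d \<in> R'" using split.prems(1) A(7) by blast
  have dp: "d [^] p \<in> R'" using subgroup_int_pow_closed[OF A(1) d] by (metis int_pow_int)
  have "(u [^] e \<otimes> d) [^] int p = u [^] (e * int p) \<otimes> d [^] int p"
    using A(3) C[OF d] by (simp only: int_pow_distrib int_pow_pow int_pow_closed)
  then have "u [^] (e * int p) \<otimes> d [^] p = \<one>"
    using split.prems(3) c by (simp add: int_pow_int)
  then have 1: "u [^] (e * int p) = inv (d [^] p)"
    using A(3) C[OF d] by (metis inv_equality int_pow_closed nat_pow_closed)
  then have ue: "u [^] (e * int p) = \<one>"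
    using A(6) subgroup.m_inv_closed[OF A(1) dp] by metis
  then have dp1: "d [^] p = \<one>" using 1 C[OF d] by (metis inv_inv inv_one nat_pow_closed)
  show ?case
  proof (cases "u [^] e = \<one>")
    case True
    then have "c = d" using c C[OF d] by simp
    then obtain t R'' m where t: "splits G R' t R''" "primary_sum G p R''"
        "ord t = p ^ Suc m" "c = t [^] (p ^ m)"
      using split.IH[of d] d split.prems(2) dp1 by blast
    obtain R\<^sub>3 where R3: "splits G R t R\<^sub>3" "splits G R\<^sub>3 u R''"
      using splits_swap[OF split.hyps(1) t(1)] by blast
    have "primary_sum G p R\<^sub>3" by (rule primary_sum.split[OF R3(2) t(2) split.hyps(3)])
    then show ?thesis using R3 t by blast
  next
    case False
    then have nd: "\<not> int (ord u) dvd e" and dv: "int (ord u) dvd e * int p"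
      using A(3) ue by (simp_all add: int_pow_eq_id)
    have p0: "p > 0" using assms(1) prime_gt_0_nat by blast
    \<comment> \<open>\<open>u^e\<close> has order exactly \<open>p\<close>. Neither an infinite
      cyclic group nor one of order prime to \<open>p\<close> contains such an element.\<close>
    have "\<exists>m. ord u = p ^ m"
    proof (rule ccontr)
      assume "\<nexists>m. ord u = p ^ m"
      then consider "ord u = 0" | "coprime (ord u) p"
        using split.hyps(3) unfolding p_power_or_infinite_order_def by auto
      then show False
      proof cases
        case 1
        then show False using dv nd p0 by simp
      next
        case 2
        then have "coprime (int (ord u)) (int p)" by simp
        then show False using dv nd by (simp add: coprime_dvd_mult_left_iff)
      qed
    qed
    then obtain M where M: "ord u = p ^ M" by blast
    have "M \<noteq> 0" using M nd by (intro notI) simp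
    then obtain m where m: "ord u = p ^ Suc m" using M by (metis not0_implies_Suc)
    \<comment> \<open>An element of order \<open>p\<close> in a cyclic group of order
      \<open>p^(m+1)\<close>: here \<open>e\<close> is \<open>p^m\<close> times a unit
      \<open>g\<close> modulo \<open>p\<close>, so \<open>u^g\<close> generates the same factor and
      its \<open>p^m\<close>-th power is \<open>u^e\<close>.\<close>
    have "int (p ^ m) dvd e" using dv p0 m by simp
    then obtain g where g: "e = int (p ^ m) * g" by (auto elim: dvdE)
    have "\<not> int p dvd g" using nd p0 unfolding m g by (auto simp: mult.commute)
    then have cop: "coprime g (int p)"
      using assms(1) prime_imp_coprime[of "int p" g] by (simp add: coprime_commute)
    let ?v = "u [^] g"
    have v: "?v \<in> carrier G" using A(3) by simp
    have gcop: "coprime g (int (ord u))" using cop m by simp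
    have "splits G R (u [^] g \<otimes> \<one>) R'" "ord (u [^] g \<otimes> \<one>) = ord u"
      by (rule splits_replace[OF split.hyps(1) subgroup.one_closed[OF A(1)] gcop]; simp)+
    then have V: "splits G R ?v R'" and ordv: "ord ?v = p ^ Suc m" using v m by simp_all
    have vm: "?v [^] (p ^ m) = u [^] e"
      using A(3) g by (metis int_pow_int int_pow_pow mult.commute)
    show ?thesis
    proof (cases "d = \<one>")
      case True
      then have "c = ?v [^] (p ^ m)" using c vm A(3) by simp
      then show ?thesis using V ordv split.hyps(2) by blast
    next
      case False
      then obtain t R'' n where t: "splits G R' t R''" "primary_sum G p R''"
          "ord t = p ^ Suc n" "d = t [^] (p ^ n)"
        using split.IH[of d] d dp1 by blast
      note B = splitsD[OF t(1)]
      show ?thesis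
      proof (cases "m \<le> n")
        case True
        \<comment> \<open>A \<open>p^m\<close>-th root of \<open>d\<close>, available because
          \<open>m \<le> n\<close>. Its order divides that of \<open>?v\<close>, which is what
          permits multiplying \<open>?v\<close> by it.\<close>
        let ?r = "t [^] (p ^ (n - m))"
        have r: "?r \<in> R'" using B(4) A(1) by (metis int_pow_int subgroup_int_pow_closed)
        have "p ^ (n - m) * p ^ Suc m = p ^ Suc n"
          using True by (simp flip: power_add)
        then have "?r [^] ord ?v = \<one>"
          using B(3) t(3) pow_ord_eq_1[OF B(3)] unfolding ordv by (simp add: nat_pow_pow del: power_Suc)
        then have "splits G R (?v [^] (1::int) \<otimes> ?r) R'" "ord (?v [^] (1::int) \<otimes> ?r) = ord ?v"
          using splits_replace[OF V r, of 1] by simp_all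
        then have S: "splits G R (?v \<otimes> ?r) R'" "ord (?v \<otimes> ?r) = p ^ Suc m"
          using v ordv by simp_all
        have "p ^ (n - m) * p ^ m = p ^ n" using True by (simp flip: power_add)
        then have "c = (?v \<otimes> ?r) [^] (p ^ m)"
          using v B(3) by (simp add: c vm t(4) pow_mult_distrib m_comm nat_pow_pow)
        then show ?thesis using S split.hyps(2) by blast
      next
        \<comment> \<open>Now \<open>t\<close> has the smaller order and has to be altered by a
          power of \<open>?v\<close>. Only a leading factor can be altered by elements of its
          complement, hence the swap.\<close>
        case False
        obtain R\<^sub>3 where R3: "splits G R t R\<^sub>3" "splits G R\<^sub>3 ?v R''"
          using splits_swap[OF V t(1)] by blast
        note E = splitsD[OF R3(2)]
        have prim: "primary_sum G p R\<^sub>3"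
        proof (rule primary_sum.split[OF R3(2) t(2)])
          show "p_power_or_infinite_order G p ?v \<or> coprime (ord ?v) p"
            unfolding p_power_or_infinite_order_def using ordv by blast
        qed
        let ?r = "?v [^] (p ^ (m - n))"
        have r: "?r \<in> R\<^sub>3" using E(4,2) by (metis int_pow_int subgroup_int_pow_closed)
        have "p ^ (m - n) * p ^ Suc n = p ^ Suc m"
          using False by (simp flip: power_add)
        then have "?r [^] ord t = \<one>"
          using v ordv pow_ord_eq_1[OF v] unfolding t(3) by (simp add: nat_pow_pow del: power_Suc)
        then have "splits G R (t [^] (1::int) \<otimes> ?r) R\<^sub>3" "ord (t [^] (1::int) \<otimes> ?r) = ord t"
          using splits_replace[OF R3(1) r, of 1] by simp_all
        then have S: "splits G R (t \<otimes> ?r) R\<^sub>3" "ord (t \<otimes> ?r) = p ^ Suc n"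
          using B(3) t(3) by simp_all
        have "p ^ (m - n) * p ^ n = p ^ m" using False by (simp flip: power_add)
        then have "c = (t \<otimes> ?r) [^] (p ^ n)"
          using v A(3) B(3) vm by (simp add: c t(4) pow_mult_distrib m_comm nat_pow_pow)
        then show ?thesis using S prim by blast
      qed
    qed
  qed
qed

text \<open>Divisibility is a linear order on the powers of \<open>p\<close> together with 0, the
  value of \<open>ord\<close> for infinite order; 0 is its largest element.\<close>

lemma p_power_or_infinite_order_dvd:
  assumes "p_power_or_infinite_order G p a" "p_power_or_infinite_order G p b"
  shows "ord a dvd ord b \<or> ord b dvd ord a"
  using assms unfolding p_power_or_infinite_order_def
  by (metis dvd_0_right le_imp_power_dvd nle_le)

text \<open>Modulo \<open>p\<close>-th powers the exponent \<open>e\<close> is invertible: with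
  \<open>e i + p j = 1\<close>, the element \<open>r^f\<close> is the \<open>e\<close>-th power of
  \<open>r^(i f)\<close> times the \<open>p\<close>-th power of \<open>r^(j f)\<close>. The first
  part merges with \<open>u^e\<close> into the new generator, which is admissible because
  \<open>ord r\<close> divides \<open>ord u\<close>.\<close>

lemma splits_replace_p_power:
  assumes "prime p" "splits G R u R'" "p_power_or_infinite_order G p u" "r \<in> R'" "ord r dvd ord u"
    "\<not> int p dvd e"
  shows "\<exists>z w. splits G R z R' \<and> p_power_or_infinite_order G p z \<and> w \<in> R' \<and>
    u [^] e \<otimes> r [^] (f::int) = z [^] e \<otimes> w [^] p"
proof -
  note A = splitsD[OF assms(2)]
  have r: "r \<in> carrier G" using subgroup.mem_carrier[OF A(1) assms(4)] .
  have "coprime e (int p)"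
    using assms(1,6) prime_imp_coprime[of "int p" e] by (simp add: coprime_commute)
  then obtain i j where ij: "e * i + int p * j = 1"
    using bezout_int[of e "int p"] by (auto simp: mult.commute)
  let ?s = "r [^] (i * f)"
  let ?w = "r [^] (j * f)"
  have s: "?s \<in> R'" and w: "?w \<in> R'" using assms(4) A(1) by (auto intro: subgroup_int_pow_closed)
  have "?s [^] ord u = \<one>"
  proof -
    have "?s [^] ord u = (r [^] ord u) [^] (i * f)"
      using r by (metis int_pow_int int_pow_pow mult.commute)
    moreover have "r [^] ord u = \<one>" using assms(5) r pow_eq_id by blast
    ultimately show ?thesis by simp
  qed
  then have S: "splits G R (u [^] (1::int) \<otimes> ?s) R'" "ord (u [^] (1::int) \<otimes> ?s) = ord u"
    using splits_replace[OF assms(2) s, of 1] by simp_all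
  let ?z = "u \<otimes> ?s"
  have S: "splits G R ?z R'" "p_power_or_infinite_order G p ?z"
    using S A(3) assms(3) by (simp_all add: p_power_or_infinite_order_def)
  have "f = i * f * e + j * f * int p"
    using arg_cong[OF ij, of "\<lambda>x. x * f"] by (simp add: algebra_simps)
  then have "r [^] f = r [^] (i * f * e) \<otimes> r [^] (j * f * int p)"
    using r by (metis int_pow_mult)
  also have "\<dots> = ?s [^] e \<otimes> ?w [^] p" using r by (metis int_pow_int int_pow_pow)
  finally have "u [^] e \<otimes> r [^] f = ?z [^] e \<otimes> ?w [^] p"
    using A(3) r by (simp add: int_pow_distrib m_assoc)
  then show ?thesis using S w by blast
qed

text \<open>By induction all components except that of \<open>u\<close> are already collected in
  \<open>z^f w^p\<close>. If \<open>u^e\<close> or \<open>z^f\<close> is a \<open>p\<close>-th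
  power, it moves into the second factor; otherwise the generator of larger order absorbs the other
  one. The moved powers may come from any factor, which is why \<open>w\<close> ranges over
  \<open>R\<close> and not only over the complement of \<open>z\<close>.\<close>

lemma primary_sum_pth_power_split:
  assumes "prime p" "primary_sum G p R" "b \<in> R"
  shows "\<exists>z R' w. \<exists>f::int. splits G R z R' \<and> primary_sum G p R' \<and>
    p_power_or_infinite_order G p z \<and> w \<in> R \<and> b = z [^] f \<otimes> w [^] p"
  using assms(2,3)
proof (induction arbitrary: b rule: primary_sum.induct)
  case trivial
  have "splits G {\<one>} \<one> {\<one>}" unfolding splits_def by (simp add: triv_subgroup)
  moreover have "p_power_or_infinite_order G p \<one>"
    unfolding p_power_or_infinite_order_def by (intro disjI1 exI[of _ 0]) simp
  moreover have "b = \<one> [^] (0::int) \<otimes> \<one> [^] p" using trivial by simp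
  ultimately show ?case using primary_sum.trivial by blast
next
  case (split R u R')
  note A = splitsD[OF split.hyps(1)]
  obtain e d where b: "b = u [^] (e::int) \<otimes> d" and d: "d \<in> R'" using split.prems A(7) by blast
  obtain z R'' w and f :: int where z: "splits G R' z R''" "primary_sum G p R''"
      "p_power_or_infinite_order G p z" and w: "w \<in> R'" and df: "d = z [^] f \<otimes> w [^] p"
    using split.IH[OF d] by blast
  note B = splitsD[OF z(1)]
  obtain R\<^sub>3 where R3: "splits G R z R\<^sub>3" "splits G R\<^sub>3 u R''"
    using splits_swap[OF split.hyps(1) z(1)] by blast
  note E = splitsD[OF R3(1)] splitsD[OF R3(2)]
  have prim: "primary_sum G p R\<^sub>3" by (rule primary_sum.split[OF R3(2) z(2) split.hyps(3)])
  have wR: "w \<in> R" and zR: "z \<in> R" using w A(5) B(4) by auto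
  have wc: "w \<in> carrier G" using subgroup.mem_carrier[OF A(1) w] .
  have u_power: "?case" if v: "v \<in> R" and ue: "u [^] e = v [^] p" for v
  proof -
    have vc: "v \<in> carrier G" using subgroup.mem_carrier[OF A(2) v] .
    have "b = z [^] f \<otimes> (v \<otimes> w) [^] p"
      using vc wc B(3) by (simp add: b df ue pow_mult_distrib m_ac)
    then show ?thesis using R3(1) prim z(3) subgroup.m_closed[OF A(2) v wR] by blast
  qed
  show ?case
  proof (cases "p_power_or_infinite_order G p u")
    case False
    then have "coprime (ord u) p" using split.hyps(3) by blast
    then have "coprime (int (ord u)) (int p)" by simp
    then obtain i j where ij: "int (ord u) * i + int p * j = 1"
      using bezout_int[of "int (ord u)" "int p"] by (auto simp: mult.commute)
    have "e = int (ord u) * (i * e) + j * e * int p"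
      using arg_cong[OF ij, of "\<lambda>x. x * e"] by (simp add: algebra_simps)
    then have "u [^] e = u [^] (int (ord u) * (i * e)) \<otimes> u [^] (j * e * int p)"
      using A(3) by (metis int_pow_mult)
    also have "u [^] (int (ord u) * (i * e)) = \<one>" using A(3) by (simp add: int_pow_eq_id)
    also have "u [^] (j * e * int p) = (u [^] (j * e)) [^] p"
      using A(3) by (metis int_pow_int int_pow_pow)
    finally have "u [^] e = (u [^] (j * e)) [^] p" using A(3) by simp
    then show ?thesis using u_power subgroup_int_pow_closed[OF A(2,4)] by blast
  next
    case u: True
    consider "int p dvd e" | "int p dvd f" | "\<not> int p dvd e" "\<not> int p dvd f" by blast
    then show ?thesis
    proof cases
      case 1
      then obtain k where "e = k * int p" by (metis dvdE mult.commute)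
      then have "u [^] e = (u [^] k) [^] p" using A(3) by (metis int_pow_int int_pow_pow)
      then show ?thesis using u_power subgroup_int_pow_closed[OF A(2,4)] by blast
    next
      case 2
      then obtain k where "f = k * int p" by (metis dvdE mult.commute)
      then have "z [^] f = (z [^] k) [^] p" using B(3) by (metis int_pow_int int_pow_pow)
      then have "b = u [^] e \<otimes> (z [^] k \<otimes> w) [^] p"
        using wc B(3) by (simp add: b df pow_mult_distrib m_comm)
      moreover have "z [^] k \<otimes> w \<in> R"
        using subgroup.m_closed[OF A(2) subgroup_int_pow_closed[OF A(2) zR] wR] .
      ultimately show ?thesis using split.hyps(1,2) u by blast
    next
      case 3
      have bb: "b = u [^] e \<otimes> z [^] f \<otimes> w [^] p" using A(3) B(3) wc by (simp add: b df m_assoc)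
      from p_power_or_infinite_order_dvd[OF u z(3)] show ?thesis
      proof
        assume "ord z dvd ord u"
        then obtain y v where y: "splits G R y R'" "p_power_or_infinite_order G p y" "v \<in> R'"
            "u [^] e \<otimes> z [^] f = y [^] e \<otimes> v [^] p"
          using splits_replace_p_power[OF assms(1) split.hyps(1) u B(4) _ 3(1)] by blast
        have vc: "v \<in> carrier G" using subgroup.mem_carrier[OF A(1) y(3)] .
        have "b = y [^] e \<otimes> (v \<otimes> w) [^] p"
          using bb y(4) vc wc splitsD(3)[OF y(1)] by (simp add: pow_mult_distrib m_ac)
        moreover have "v \<otimes> w \<in> R" using y(3) w A(5) subgroup.m_closed[OF A(1)] by blast
        ultimately show ?thesis using y(1,2) split.hyps(2) by blast
      next
        assume "ord u dvd ord z"
        then obtain y v where y: "splits G R y R\<^sub>3" "p_power_or_infinite_order G p y" "v \<in> R\<^sub>3"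
            "z [^] f \<otimes> u [^] e = y [^] f \<otimes> v [^] p"
          using splits_replace_p_power[OF assms(1) R3(1) z(3) E(11) _ 3(2)] by blast
        have vc: "v \<in> carrier G" using subgroup.mem_carrier[OF E(1) y(3)] .
        have "b = (z [^] f \<otimes> u [^] e) \<otimes> w [^] p" using bb A(3) B(3) by (simp add: m_comm)
        then have "b = y [^] f \<otimes> (v \<otimes> w) [^] p"
          using y(4) vc wc splitsD(3)[OF y(1)] by (simp add: pow_mult_distrib m_ac)
        moreover have "v \<otimes> w \<in> R"
          using y(3) wR E(5) subgroup.m_closed[OF A(2)] by blast
        ultimately show ?thesis using y(1,2) prim by blast
      qed
    qed
  qed
qed

section \<open>From elementwise splittings to internal direct products\<close>

lemma subgroup_comm_group: "subgroup H G \<Longrightarrow> comm_group (G\<lparr>carrier := H\<rparr>)"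
  by (rule group.group_comm_groupI[OF subgroup_imp_group]) (auto dest: subgroup.mem_carrier intro: m_comm)

lemma splits_generate:
  "splits G R u R' \<Longrightarrow> R = generate G {u} <#> R'"
  "splits G R u R' \<Longrightarrow> generate G {u} \<inter> R' = {\<one>}"
proof -
  assume S: "splits G R u R'"
  note A = splitsD[OF S]
  have u: "generate G {u} = {u [^] (k::int) | k. k \<in> UNIV}" using generate_pow[OF A(3)] .
  show "R = generate G {u} <#> R'" unfolding set_mult_def u A(7) by auto
  show "generate G {u} \<inter> R' = {\<one>}"
    using A(6) subgroup.one_closed[OF A(1)] generate.one[of G "{u}"] unfolding u by auto
qed

text \<open>The splittings nest to the right, the definition brackets to the left. Directness
  carries over by peeling off components: if \<open>h k\<close> with \<open>h\<close> a power of
  \<open>a\<close> and \<open>k\<close> a power of \<open>b\<close> is a power of \<open>c\<close>,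
  it lies in \<open>R\<close>, so \<open>h = \<one>\<close>; then \<open>k\<close> lies in
  \<open>R'\<close>, so \<open>k = \<one>\<close>.\<close>

lemma splits_direct_product_of_three_cyclic:
  assumes "splits G (carrier G) a R" "splits G R b R'" "splits G R' c {\<one>}"
  shows "direct_product_of_three_cyclic G a b c"
proof -
  note A = splitsD[OF assms(1)] and B = splitsD[OF assms(2)] and C = splitsD[OF assms(3)]
  let ?a = "generate G {a}" and ?b = "generate G {b}" and ?c = "generate G {c}"
  have sub: "subgroup ?a G" "subgroup ?b G" "subgroup ?c G"
    using A(3) B(3) C(3) by (simp_all add: generate_is_subgroup)
  have ab: "subgroup (?a <#> ?b) G" using sub by (simp add: mult_subgroups)
  interpret ab: comm_group "G\<lparr>carrier := ?a <#> ?b\<rparr>"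
    by (rule subgroup_comm_group[OF ab])
  have "x \<otimes> \<one> = x" if "x \<in> ?c" for x using subgroup.mem_carrier[OF sub(3) that] by simp
  then have R': "R' = ?c" using splits_generate(1)[OF assms(3)] by (auto simp: set_mult_def)
  have bR: "?b \<subseteq> R" using B(2,4) by (simp add: generate_subgroup_incl)
  have abs: "?a \<subseteq> ?a <#> ?b" "?b \<subseteq> ?a <#> ?b"
  proof -
    have "g = g \<otimes> \<one>" if "g \<in> ?a" for g using subgroup.mem_carrier[OF sub(1) that] by simp
    then show "?a \<subseteq> ?a <#> ?b" unfolding set_mult_def using generate.one[of G "{b}"] by blast
    have "g = \<one> \<otimes> g" if "g \<in> ?b" for g using subgroup.mem_carrier[OF sub(2) that] by simp
    then show "?b \<subseteq> ?a <#> ?b" unfolding set_mult_def using generate.one[of G "{a}"] by blast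
  qed
  have "?a \<inter> ?b = {\<one>}"
    using splits_generate(2)[OF assms(1)] bR generate.one[of G "{b}"] generate.one[of G "{a}"] by blast
  then have 1: "internal_direct_product (G\<lparr>carrier := ?a <#> ?b\<rparr>) ?a ?b"
    unfolding internal_direct_product_def
    using abs sub by (auto intro!: ab.subgroup_imp_normal subgroup_incl ab)
  have "(?a <#> ?b) \<inter> ?c \<subseteq> {\<one>}"
  proof
    fix g assume g: "g \<in> (?a <#> ?b) \<inter> ?c"
    then obtain h k where hk: "g = h \<otimes> k" "h \<in> ?a" "k \<in> ?b" unfolding set_mult_def by auto
    have c: "h \<in> carrier G" "k \<in> carrier G" "g \<in> carrier G"
      using hk sub by (auto dest: subgroup.mem_carrier)
    have "g \<in> R" "k \<in> R" using g R' B(5) hk bR by auto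
    then have "g \<otimes> inv k \<in> R" using B(1) splitsD(1)[OF assms(1)]
      by (simp add: subgroup.m_closed subgroup.m_inv_closed)
    then have "h \<in> R" using hk(1) c by (simp add: m_assoc)
    then have "h = \<one>" using splits_generate(2)[OF assms(1)] hk(2) by blast
    then have "k \<in> ?c" using hk(1) c g by simp
    then have "k = \<one>" using splits_generate(2)[OF assms(2)] hk(3) R' by blast
    then show "g \<in> {\<one>}" using hk(1) \<open>h = \<one>\<close> by simp
  qed
  moreover have "?a <#> ?b <#> ?c = carrier G"
    using splits_generate(1)[OF assms(1)] splits_generate(1)[OF assms(2)] R'
      set_mult_assoc[OF sub[THEN subgroup.subset]] by simp
  ultimately have "internal_direct_product G (?a <#> ?b) ?c"
    unfolding internal_direct_product_def
    using ab sub(3) subgroup.one_closed[OF ab] subgroup.one_closed[OF sub(3)]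
    by (auto intro!: subgroup_imp_normal)
  with 1 show ?thesis unfolding direct_product_of_three_cyclic_def using A(3) B(3) C(3) by blast
qed

end

section \<open>The center of a group\<close>

context group
begin

lemma group_centerD:
  "z \<in> group_center G \<Longrightarrow> z \<in> carrier G"
  "z \<in> group_center G \<Longrightarrow> g \<in> carrier G \<Longrightarrow> z \<otimes> g = g \<otimes> z"
  by (auto simp: group_center_def)

lemma group_center_subgroup: "subgroup (group_center G) G"
proof
  show "group_center G \<subseteq> carrier G" "\<one> \<in> group_center G" by (auto simp: group_center_def)
  fix a assume a: "a \<in> group_center G"
  note ac = group_centerD[OF a]
  show "inv a \<in> group_center G" unfolding group_center_def
  proof (safe intro!: inv_closed ac(1))
    fix g assume g: "g \<in> carrier G"
    have "inv (a \<otimes> inv g) = inv (inv g \<otimes> a)" using ac(2) g by simp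
    then show "inv a \<otimes> g = g \<otimes> inv a" using ac(1) g by (simp add: inv_mult_group)
  qed
  fix b assume b: "b \<in> group_center G"
  note bc = group_centerD[OF b]
  show "a \<otimes> b \<in> group_center G" unfolding group_center_def
  proof (safe intro!: m_closed ac(1) bc(1))
    fix g assume g: "g \<in> carrier G"
    have "a \<otimes> b \<otimes> g = a \<otimes> g \<otimes> b" using ac(1) bc g by (simp add: m_assoc)
    also have "\<dots> = g \<otimes> (a \<otimes> b)" using ac bc(1) g by (simp add: m_assoc)
    finally show "a \<otimes> b \<otimes> g = g \<otimes> (a \<otimes> b)" .
  qed
qed

lemma group_center_comm_group: "comm_group (G\<lparr>carrier := group_center G\<rparr>)"
  by (rule group.group_comm_groupI[OF subgroup_imp_group[OF group_center_subgroup]])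
    (auto dest: group_centerD)

lemma central_subgroup_normal:
  assumes "subgroup A G" "A \<subseteq> group_center G"
  shows "A \<lhd> G"
  unfolding normal_inv_iff
proof (intro conjI ballI assms(1))
  fix g a assume g: "g \<in> carrier G" and a: "a \<in> A"
  then have "g \<otimes> a = a \<otimes> g" "a \<in> carrier G" using assms(2) group_centerD[of a] by auto
  then show "g \<otimes> a \<otimes> inv g \<in> A" using g a by (simp add: m_assoc)
qed

lemma int_pow_conj:
  assumes "g \<in> carrier G" "h \<in> carrier G"
  shows "(g \<otimes> h \<otimes> inv g) [^] (k::int) = g \<otimes> h [^] k \<otimes> inv g"
proof -
  have "(\<lambda>h. g \<otimes> h \<otimes> inv g) \<in> hom G G"
    using assms(1) by (auto simp: hom_def m_assoc) (simp flip: m_assoc)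
  from hom_int_pow[OF this assms(2) is_group is_group] show ?thesis by simp
qed

end

section \<open>Pairs of elements with a central commutator\<close>

locale central_commutator = group G for G (structure) +
  fixes x y
  assumes xy [simp, intro]: "x \<in> carrier G" "y \<in> carrier G"
    and commutator_central: "inv x \<otimes> inv y \<otimes> x \<otimes> y \<in> group_center G"
begin

definition c where "c = inv x \<otimes> inv y \<otimes> x \<otimes> y"

lemma c_center: "c \<in> group_center G"
  using commutator_central by (simp add: c_def)

lemma c_closed [simp, intro]: "c \<in> carrier G"
  using c_center group_centerD by blast

lemma xy_swap: "x \<otimes> y = y \<otimes> x \<otimes> c"
  unfolding c_def by (simp add: m_assoc) (simp flip: m_assoc)

lemma center_int_pow: "z \<in> group_center G \<Longrightarrow> z [^] (k::int) \<in> group_center G"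
  by (rule subgroup_int_pow_closed[OF group_center_subgroup])

text \<open>Two conjugations give the double exponent: \<open>x\<close> conjugates \<open>y\<close>
  to \<open>y c\<close>, hence \<open>y^j\<close> to \<open>y^j c^j\<close>; so \<open>y^j\<close>
  conjugates \<open>x\<close> to \<open>x c^(-j)\<close>, hence \<open>x^k\<close> to
  \<open>x^k c^(-j k)\<close>.\<close>

lemma y_pow_x_pow: "y [^] (j::int) \<otimes> x [^] (k::int) = x [^] k \<otimes> (y [^] j \<otimes> c [^] - (j * k))"
proof -
  have "x \<otimes> y = y \<otimes> c \<otimes> x"
    using xy_swap group_centerD(2)[OF c_center, of x] by (simp add: m_assoc)
  then have "x \<otimes> y \<otimes> inv x = y \<otimes> c" by (simp add: m_assoc)
  then have "x \<otimes> y [^] j \<otimes> inv x = y [^] j \<otimes> c [^] j"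
    using int_pow_conj[of x y j] group_centerD(2)[OF c_center, of y]
    by (simp add: int_pow_mult_distrib)
  then have "x \<otimes> y [^] j = y [^] j \<otimes> c [^] j \<otimes> x"
    by (metis inv_closed inv_solve_right int_pow_closed m_closed inv_inv xy c_closed)
  also have "\<dots> = y [^] j \<otimes> x \<otimes> c [^] j"
    using group_centerD(2)[OF center_int_pow[OF c_center], of x] by (simp add: m_assoc)
  finally have "x \<otimes> y [^] j \<otimes> c [^] (- j) = y [^] j \<otimes> x"
    by (simp add: m_assoc int_pow_neg)
  then have "y [^] j \<otimes> x \<otimes> inv (y [^] j) = x \<otimes> c [^] (- j)"
    using group_centerD(2)[OF center_int_pow[OF c_center], of "inv (y [^] j)"]
    by (simp flip: \<open>x \<otimes> y [^] j \<otimes> c [^] (- j) = y [^] j \<otimes> x\<close> add: m_assoc) (simp flip: m_assoc)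
  moreover have "(x \<otimes> c [^] (- j)) [^] k = x [^] k \<otimes> c [^] (- (j * k))"
    using group_centerD(2)[OF center_int_pow[OF c_center], of x]
    by (simp add: int_pow_mult_distrib int_pow_pow)
  ultimately have "y [^] j \<otimes> x [^] k \<otimes> inv (y [^] j) = x [^] k \<otimes> c [^] (- (j * k))"
    using int_pow_conj[of "y [^] j" x k] by simp
  then have "y [^] j \<otimes> x [^] k = x [^] k \<otimes> c [^] (- (j * k)) \<otimes> y [^] j"
    by (metis inv_closed inv_solve_right int_pow_closed m_closed inv_inv xy c_closed)
  then show ?thesis
    using group_centerD(2)[OF center_int_pow[OF c_center], of "y [^] j"] by (simp add: m_assoc)
qed

text \<open>Collection in nilpotency class two: only \<open>y^j\<close> and \<open>x^k\<close> have
  to be interchanged, at the cost of a power of \<open>c\<close>, and everything else that moves is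
  central. All later arguments are computations with the exponents.\<close>

lemma mult_form:
  fixes i j k l :: int
  assumes z: "z \<in> group_center G" and w: "w \<in> group_center G"
  shows "(x [^] i \<otimes> y [^] j \<otimes> z) \<otimes> (x [^] k \<otimes> y [^] l \<otimes> w) =
    x [^] (i + k) \<otimes> y [^] (j + l) \<otimes> (c [^] (- (j * k)) \<otimes> z \<otimes> w)" (is "?L = ?R")
proof -
  let ?d = "c [^] (- (j * k))"
  have d: "?d \<in> group_center G" by (rule center_int_pow[OF c_center])
  have C: "z \<in> carrier G" "w \<in> carrier G" "?d \<in> carrier G"
    using z w d group_centerD by auto
  have push: "v \<otimes> (g \<otimes> h) = g \<otimes> (v \<otimes> h)"
    if "v \<in> group_center G" "g \<in> carrier G" "h \<in> carrier G" for v g h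
    using that group_centerD[OF that(1)] by (metis m_assoc)
  have "?L = x [^] i \<otimes> (y [^] j \<otimes> (z \<otimes> (x [^] k \<otimes> (y [^] l \<otimes> w))))"
    using C by (simp add: m_assoc)
  also have "z \<otimes> (x [^] k \<otimes> (y [^] l \<otimes> w)) = x [^] k \<otimes> (y [^] l \<otimes> (z \<otimes> w))"
    using C by (simp add: push[OF z, of "x [^] k"] push[OF z, of "y [^] l"])
  also have "y [^] j \<otimes> (x [^] k \<otimes> (y [^] l \<otimes> (z \<otimes> w))) =
      (y [^] j \<otimes> x [^] k) \<otimes> (y [^] l \<otimes> (z \<otimes> w))"
    using C by (simp add: m_assoc)
  also have "\<dots> = x [^] k \<otimes> (y [^] j \<otimes> (?d \<otimes> (y [^] l \<otimes> (z \<otimes> w))))"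
    unfolding y_pow_x_pow using C by (simp add: m_assoc)
  also have "?d \<otimes> (y [^] l \<otimes> (z \<otimes> w)) = y [^] l \<otimes> (?d \<otimes> (z \<otimes> w))"
    using C by (simp add: push[OF d])
  finally show ?thesis using C by (simp add: m_assoc int_pow_mult)
qed

text \<open>\<open>N\<close> is kept variable because subgroups of the center not yet known to be
  all of it are needed: a finitely generated one, to show that the center is finitely generated, and
  a product of three cyclic groups, to find a complement of what is left of the center.\<close>

definition span where
  "span N = {x [^] (i::int) \<otimes> y [^] (j::int) \<otimes> n | i j n. n \<in> N}"

lemma span_subgroup:
  assumes "subgroup N G" "N \<subseteq> group_center G" "c \<in> N"
  shows "subgroup (span N) G"
proof
  note N = subgroup.mem_carrier[OF assms(1)]
  show "span N \<subseteq> carrier G" using N by (auto simp: span_def)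
  have "\<one> = x [^] (0::int) \<otimes> y [^] (0::int) \<otimes> \<one>" by simp
  then show "\<one> \<in> span N" unfolding span_def using subgroup.one_closed[OF assms(1)] by blast
  have cN: "c [^] (k::int) \<in> N" for k by (rule subgroup_int_pow_closed[OF assms(1,3)])
  have closed: "a \<otimes> b \<in> span N" if ab: "a \<in> span N" "b \<in> span N" for a b
  proof -
    obtain i j n where a: "a = x [^] (i::int) \<otimes> y [^] (j::int) \<otimes> n" "n \<in> N"
      using ab(1) unfolding span_def by blast
    obtain k l m where b: "b = x [^] (k::int) \<otimes> y [^] (l::int) \<otimes> m" "m \<in> N"
      using ab(2) unfolding span_def by blast
    have "a \<otimes> b = x [^] (i + k) \<otimes> y [^] (j + l) \<otimes> (c [^] (- (j * k)) \<otimes> n \<otimes> m)"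
      unfolding a b using a(2) b(2) assms(2) by (intro mult_form) auto
    moreover have "c [^] (- (j * k)) \<otimes> n \<otimes> m \<in> N"
      using a(2) b(2) cN assms(1) by (simp add: subgroup.m_closed)
    ultimately show ?thesis unfolding span_def by blast
  qed
  then show "a \<otimes> b \<in> span N" if "a \<in> span N" "b \<in> span N" for a b using that .
  show "inv a \<in> span N" if aS: "a \<in> span N" for a
  proof -
    obtain i j n where a: "a = x [^] (i::int) \<otimes> y [^] (j::int) \<otimes> n" and n: "n \<in> N"
      using aS unfolding span_def by blast
    \<comment> \<open>The power of \<open>c\<close> compensates for the one that
      \<open>mult_form\<close> produces when \<open>y^j\<close> passes
      \<open>x^(-i)\<close>.\<close>
    let ?b = "x [^] (- i) \<otimes> y [^] (- j) \<otimes> (inv n \<otimes> c [^] (- (j * i)))"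
    have m: "inv n \<otimes> c [^] (- (j * i)) \<in> N"
      using n cN assms(1) by (simp add: subgroup.m_closed subgroup.m_inv_closed)
    have "a \<otimes> ?b = x [^] (i + - i) \<otimes> y [^] (j + - j) \<otimes>
        (c [^] (- (j * - i)) \<otimes> n \<otimes> (inv n \<otimes> c [^] (- (j * i))))"
      unfolding a using n m assms(2) by (intro mult_form) auto
    also have "\<dots> = \<one>"
      using N[OF n] by (simp add: m_assoc int_pow_neg) (simp flip: m_assoc)
    finally have "inv a = ?b"
      using N[OF n] a by (intro inv_equality[OF inv_comm]) auto
    then show ?thesis unfolding span_def using m by blast
  qed
qed

lemma span_contains:
  assumes "subgroup N G"
  shows "x \<in> span N" "y \<in> span N" "N \<subseteq> span N"
proof -
  note o = subgroup.one_closed[OF assms]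
  have "x = x [^] (1::int) \<otimes> y [^] (0::int) \<otimes> \<one>" "y = x [^] (0::int) \<otimes> y [^] (1::int) \<otimes> \<one>"
    by simp_all
  then show "x \<in> span N" "y \<in> span N" unfolding span_def using o by blast+
  show "N \<subseteq> span N"
  proof
    fix n assume n: "n \<in> N"
    then have "n = x [^] (0::int) \<otimes> y [^] (0::int) \<otimes> n" using subgroup.mem_carrier[OF assms] by simp
    then show "n \<in> span N" unfolding span_def using n by blast
  qed
qed

lemma span_eq_generate:
  assumes "subgroup N G" "N \<subseteq> group_center G" "c \<in> N"
  shows "span N = generate G ({x, y} \<union> N)"
proof
  define H where "H = generate G ({x, y} \<union> N)"
  have sub: "subgroup H G"
    using subgroup.subset[OF assms(1)] unfolding H_def by (intro generate_is_subgroup) auto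
  show "generate G ({x, y} \<union> N) \<subseteq> span N"
    using span_contains[OF assms(1)] by (intro generate_subgroup_incl span_subgroup assms) auto
  have "x \<in> H" "y \<in> H" "N \<subseteq> H" unfolding H_def by (auto intro: generate.incl)
  then have "span N \<subseteq> H"
    unfolding span_def
    by (auto intro!: subgroup.m_closed[OF sub] subgroup_int_pow_closed[OF sub])
  then show "span N \<subseteq> generate G ({x, y} \<union> N)" by (simp add: H_def)
qed

end

section \<open>The alternating form on exponents modulo \<open>p\<close>\<close>

locale center_quotient_pair = central_commutator +
  fixes p :: nat
  assumes prime: "prime p"
    and noncommuting: "inv x \<otimes> inv y \<otimes> x \<otimes> y \<noteq> \<one>"
    and pow_central: "x [^] p \<in> group_center G" "y [^] p \<in> group_center G"
    and carrier_span: "carrier G = {x [^] (i::int) \<otimes> y [^] (j::int) \<otimes> z | i j z. z \<in> group_center G}"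
begin

lemma c_ne_one: "c \<noteq> \<one>"
  using noncommuting by (simp add: c_def)

text \<open>Moving \<open>x\<close> past \<open>y^p\<close> costs \<open>c^(-p)\<close>; as
  \<open>y^p\<close> is central, this factor is trivial.\<close>

lemma c_pow_p: "c [^] p = \<one>"
proof -
  have "y [^] int p \<otimes> x [^] (1::int) = x [^] (1::int) \<otimes> (y [^] int p \<otimes> c [^] - (int p * 1))"
    by (rule y_pow_x_pow)
  moreover have "y [^] int p \<otimes> x = x \<otimes> y [^] int p"
    using group_centerD(2)[OF pow_central(2), of x] by (simp add: int_pow_int)
  ultimately have "x \<otimes> y [^] int p = x \<otimes> y [^] int p \<otimes> c [^] - int p" by (simp add: m_assoc)
  then have "c [^] - int p = \<one>" using l_cancel_one' by simp
  then show ?thesis by (metis c_closed int_pow_int int_pow_neg inv_eq_1_iff int_pow_closed)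
qed

lemma c_pow_eq_one: "c [^] (k::int) = \<one> \<longleftrightarrow> int p dvd k"
proof -
  have "ord c dvd p" using c_pow_p by (simp add: pow_eq_id)
  then have "ord c = p" using prime c_ne_one ord_eq_1[OF c_closed] by (metis prime_nat_iff)
  then show ?thesis by (simp add: int_pow_eq_id)
qed

text \<open>By \<open>mult_form\<close> the two products differ only in the powers of
  \<open>c\<close>, and \<open>c\<close> has order \<open>p\<close>. Commuting thus becomes the
  vanishing of an alternating form over the field with \<open>p\<close> elements.\<close>

lemma commute_iff:
  fixes i j k l :: int
  assumes z: "z \<in> group_center G" and w: "w \<in> group_center G"
  shows "(x [^] i \<otimes> y [^] j \<otimes> z) \<otimes> (x [^] k \<otimes> y [^] l \<otimes> w) =
      (x [^] k \<otimes> y [^] l \<otimes> w) \<otimes> (x [^] i \<otimes> y [^] j \<otimes> z) \<longleftrightarrow> int p dvd (i * l - j * k)"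
proof -
  have C: "z \<in> carrier G" "w \<in> carrier G" using z w group_centerD by auto
  have wz: "w \<otimes> z = z \<otimes> w" using group_centerD(2)[OF w C(1)] .
  have "?thesis \<longleftrightarrow> (c [^] (- (j * k)) = c [^] (- (l * i)) \<longleftrightarrow> int p dvd (i * l - j * k))"
    unfolding mult_form[OF z w] mult_form[OF w z] using C wz
    by (simp add: m_assoc add.commute)
  also have "c [^] (- (j * k)) = c [^] (- (l * i)) \<longleftrightarrow> c [^] (i * l - j * k) = \<one>"
  proof -
    have "c [^] (i * l - j * k) = c [^] (- (j * k)) \<otimes> inv (c [^] (- (l * i)))"
      by (simp add: int_pow_neg flip: int_pow_mult int_pow_neg) (simp add: algebra_simps)
    then show ?thesis by (metis c_closed int_pow_closed inv_closed inv_equality inv_inv r_inv)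
  qed
  finally show ?thesis using c_pow_eq_one by simp
qed

text \<open>Nondegeneracy of the form: pairing with \<open>y\<close> yields \<open>i\<close>, and
  pairing with \<open>x\<close> yields \<open>j\<close> up to sign.\<close>

lemma form_center_iff:
  fixes i j :: int
  assumes z: "z \<in> group_center G"
  shows "x [^] i \<otimes> y [^] j \<otimes> z \<in> group_center G \<longleftrightarrow> int p dvd i \<and> int p dvd j" (is "?g \<in> _ \<longleftrightarrow> _")
proof
  have one: "\<one> \<in> group_center G" using subgroup.one_closed[OF group_center_subgroup] .
  have zc: "z \<in> carrier G" using z group_centerD by auto
  {
    assume g: "?g \<in> group_center G"
    have "?g \<otimes> (x [^] (0::int) \<otimes> y [^] (1::int) \<otimes> \<one>) = (x [^] (0::int) \<otimes> y [^] (1::int) \<otimes> \<one>) \<otimes> ?g"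
      by (rule group_centerD(2)[OF g]) auto
    then have 1: "int p dvd i" using commute_iff[OF z one, of i j 0 1] by simp
    have "?g \<otimes> (x [^] (1::int) \<otimes> y [^] (0::int) \<otimes> \<one>) = (x [^] (1::int) \<otimes> y [^] (0::int) \<otimes> \<one>) \<otimes> ?g"
      by (rule group_centerD(2)[OF g]) auto
    then show "int p dvd i \<and> int p dvd j" using commute_iff[OF z one, of i j 1 0] 1 by simp
  next
    assume d: "int p dvd i \<and> int p dvd j"
    show "?g \<in> group_center G" unfolding group_center_def
    proof (safe)
      show "?g \<in> carrier G" using zc by simp
      fix h assume "h \<in> carrier G"
      then obtain k l w where h: "h = x [^] (k::int) \<otimes> y [^] (l::int) \<otimes> w" and w: "w \<in> group_center G"
        using carrier_span by blast
      have "int p dvd i * l - j * k" using d by auto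
      then show "?g \<otimes> h = h \<otimes> ?g" unfolding h using commute_iff[OF z w] by simp
    qed
  }
qed

text \<open>The exponent vectors of \<open>a\<close> and \<open>b\<close> form a basis of the plane
  over the field with \<open>p\<close> elements, and that of \<open>g\<close> is orthogonal to both,
  hence zero. The two identities in the proof are Cramer's rule, with determinant
  \<open>i * l - j * k\<close>.\<close>

lemma centralizer_of_noncommuting:
  assumes "a \<in> carrier G" "b \<in> carrier G" "a \<otimes> b \<noteq> b \<otimes> a" "g \<in> carrier G"
    "g \<otimes> a = a \<otimes> g" "g \<otimes> b = b \<otimes> g"
  shows "g \<in> group_center G"
proof -
  obtain i j u where a: "a = x [^] (i::int) \<otimes> y [^] (j::int) \<otimes> u" and u: "u \<in> group_center G"
    using assms(1) carrier_span by blast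
  obtain k l v where b: "b = x [^] (k::int) \<otimes> y [^] (l::int) \<otimes> v" and v: "v \<in> group_center G"
    using assms(2) carrier_span by blast
  obtain r s w where g: "g = x [^] (r::int) \<otimes> y [^] (s::int) \<otimes> w" and w: "w \<in> group_center G"
    using assms(4) carrier_span by blast
  have ab: "\<not> int p dvd (i * l - j * k)" using assms(3) commute_iff[OF u v] unfolding a b by blast
  have ga: "int p dvd (r * j - s * i)" using assms(5) commute_iff[OF w u] unfolding a g by blast
  have gb: "int p dvd (r * l - s * k)" using assms(6) commute_iff[OF w v] unfolding b g by blast
  have "int p dvd (r * l - s * k) * i - (r * j - s * i) * k" by (rule dvd_diff[OF dvd_mult2[OF gb] dvd_mult2[OF ga]])
  moreover have "(r * l - s * k) * i - (r * j - s * i) * k = r * (i * l - j * k)"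
    by (simp add: algebra_simps)
  ultimately have r: "int p dvd r" using prime ab by (metis prime_dvd_mult_iff prime_int_nat_transfer prime_nat_int_transfer)
  have "int p dvd (r * l - s * k) * j - (r * j - s * i) * l" by (rule dvd_diff[OF dvd_mult2[OF gb] dvd_mult2[OF ga]])
  moreover have "(r * l - s * k) * j - (r * j - s * i) * l = s * (i * l - j * k)"
    by (simp add: algebra_simps)
  ultimately have s: "int p dvd s" using prime ab by (metis prime_dvd_mult_iff prime_int_nat_transfer prime_nat_int_transfer)
  show ?thesis unfolding g using form_center_iff[OF w] r s by blast
qed

text \<open>Subgroups of finitely generated groups need not be finitely generated, but generators
  can be named here: the central parts of the generators of \<open>G\<close>, together with
  \<open>c\<close>, \<open>x^p\<close> and \<open>y^p\<close>. For the group \<open>N\<close> they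
  generate, \<open>span N\<close> is all of \<open>G\<close>; a central element of
  \<open>span N\<close> has exponents divisible by \<open>p\<close> and so lies in
  \<open>N\<close>.\<close>

lemma center_finitely_generated:
  assumes "finitely_generated_group G"
  shows "\<exists>T. finite T \<and> T \<subseteq> group_center G \<and> generate G T = group_center G"
proof -
  obtain S where S: "finite S" "S \<subseteq> carrier G" "generate G S = carrier G"
    using assms unfolding finitely_generated_group_def by blast
  have "\<forall>s\<in>S. \<exists>z \<in> group_center G. \<exists>i j. s = x [^] (i::int) \<otimes> y [^] (j::int) \<otimes> z"
    using S(2) carrier_span by blast
  then obtain f where f: "\<And>s. s \<in> S \<Longrightarrow> f s \<in> group_center G"
      "\<And>s. s \<in> S \<Longrightarrow> \<exists>i j. s = x [^] (i::int) \<otimes> y [^] (j::int) \<otimes> f s"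
    by metis
  let ?T = "{c, x [^] p, y [^] p} \<union> f ` S"
  define N where "N = generate G ?T"
  have T: "finite ?T" "?T \<subseteq> group_center G" using S(1) f(1) c_center pow_central by auto
  have N: "subgroup N G" unfolding N_def using T(2) group_centerD(1) by (intro generate_is_subgroup) blast
  have NZ: "N \<subseteq> group_center G" unfolding N_def using T(2) by (rule generate_subgroup_incl[OF _ group_center_subgroup])
  have cN: "c \<in> N" unfolding N_def by (auto intro: generate.incl)
  have "S \<subseteq> span N"
  proof
    fix s assume s: "s \<in> S"
    then have "f s \<in> N" unfolding N_def by (auto intro: generate.incl)
    then show "s \<in> span N" unfolding span_def using f(2)[OF s] by blast
  qed
  then have full: "carrier G \<subseteq> span N"
    using generate_subgroup_incl[OF _ span_subgroup[OF N NZ cN]] S(3) by auto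
  have "group_center G \<subseteq> N"
  proof
    fix z assume z: "z \<in> group_center G"
    then obtain i j n where zf: "z = x [^] (i::int) \<otimes> y [^] (j::int) \<otimes> n" and n: "n \<in> N"
      using full group_centerD(1) unfolding span_def by blast
    have "int p dvd i" "int p dvd j" using form_center_iff[of n i j] z zf n NZ by auto
    then obtain k l where "i = int p * k" "j = int p * l" by (auto elim!: dvdE)
    then have "z = (x [^] p) [^] k \<otimes> (y [^] p) [^] l \<otimes> n"
      unfolding zf by (simp add: int_pow_pow flip: int_pow_int)
    moreover have "x [^] p \<in> N" "y [^] p \<in> N" unfolding N_def by (auto intro: generate.incl)
    ultimately show "z \<in> N"
      using n by (simp add: subgroup.m_closed[OF N] subgroup_int_pow_closed[OF N])
  qed
  then have "generate G ?T = group_center G" using NZ N_def by blast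
  then show ?thesis using T by (intro exI[of _ ?T]) simp
qed

text \<open>Comparing the two expressions exhibits \<open>x^(k-i) y^(l-j)\<close> as the central
  element \<open>z \<otimes> inv w\<close>, and \<open>form_center_iff\<close> applies.\<close>

lemma form_unique:
  fixes i j k l :: int
  assumes z: "z \<in> group_center G" and w: "w \<in> group_center G"
    and eq: "x [^] i \<otimes> y [^] j \<otimes> z = x [^] k \<otimes> y [^] l \<otimes> w"
  shows "i mod int p = k mod int p" "j mod int p = l mod int p"
proof -
  have C: "z \<in> carrier G" "w \<in> carrier G" using z w group_centerD by auto
  have wz: "inv w \<in> group_center G" "z \<otimes> inv w \<in> group_center G"
    using z w group_center_subgroup by (simp_all add: subgroup.m_closed subgroup.m_inv_closed)
  have "x [^] (k - i) \<otimes> y [^] l \<otimes> w = inv (x [^] i) \<otimes> (x [^] k \<otimes> y [^] l \<otimes> w)"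
    using C int_pow_mult[OF xy(1), of "- i" k] by (simp add: m_assoc int_pow_neg)
  also have "\<dots> = y [^] j \<otimes> z" unfolding eq[symmetric] using C by (simp add: m_assoc) (simp flip: m_assoc)
  finally have *: "x [^] (k - i) \<otimes> y [^] l \<otimes> w = y [^] j \<otimes> z" .
  have "x [^] (k - i) \<otimes> y [^] (l - j) = x [^] (k - i) \<otimes> y [^] l \<otimes> inv (y [^] j)"
    using C by (simp add: m_assoc int_pow_diff)
  also have "\<dots> = x [^] (k - i) \<otimes> y [^] l \<otimes> w \<otimes> inv w \<otimes> inv (y [^] j)"
    using C by (simp add: m_assoc)
  also have "\<dots> = y [^] j \<otimes> (z \<otimes> inv w) \<otimes> inv (y [^] j)" unfolding * using C by (simp add: m_assoc)
  also have "\<dots> = z \<otimes> inv w"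
    using group_centerD(1)[OF wz(2)] group_centerD(2)[OF wz(2), of "y [^] j"] C by (metis inv_closed int_pow_closed m_assoc r_inv r_one xy(2))
  finally have "x [^] (k - i) \<otimes> y [^] (l - j) \<otimes> \<one> \<in> group_center G" using wz C by simp
  then have "int p dvd k - i" "int p dvd l - j"
    using form_center_iff[OF subgroup.one_closed[OF group_center_subgroup]] by auto
  then show "i mod int p = k mod int p" "j mod int p = l mod int p"
    by (metis mod_eq_dvd_iff)+
qed

lemma quotient_iso: "G Mod group_center G \<cong> integer_mod_group p \<times>\<times> integer_mod_group p"
proof -
  let ?C = "integer_mod_group p" and ?Z = "group_center G"
  \<comment> \<open>The exponents themselves are not determined by \<open>g\<close>; their residues
    are, by \<open>form_unique\<close>, so the choice is harmless.\<close>
  define \<theta> where "\<theta> g = (SOME a. \<exists>i j z. z \<in> ?Z \<and> g = x [^] (i::int) \<otimes> y [^] (j::int) \<otimes> z \<and>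
    a = (i mod int p, j mod int p))" for g
  have \<theta>: "\<theta> (x [^] i \<otimes> y [^] j \<otimes> z) = (i mod int p, j mod int p)" if z: "z \<in> ?Z" for i j z
    unfolding \<theta>_def
  proof (rule some_equality)
    show "\<exists>i' j' z'. z' \<in> ?Z \<and> x [^] i \<otimes> y [^] j \<otimes> z = x [^] (i'::int) \<otimes> y [^] (j'::int) \<otimes> z' \<and>
        (i mod int p, j mod int p) = (i' mod int p, j' mod int p)" using z by blast
    fix a assume "\<exists>i' j' z'. z' \<in> ?Z \<and> x [^] i \<otimes> y [^] j \<otimes> z = x [^] (i'::int) \<otimes> y [^] (j'::int) \<otimes> z' \<and>
        a = (i' mod int p, j' mod int p)"
    then show "a = (i mod int p, j mod int p)" using form_unique[OF z] by metis
  qed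
  have p0: "p > 0" using prime prime_gt_0_nat by blast
  have one: "\<one> \<in> ?Z" using subgroup.one_closed[OF group_center_subgroup] .
  have "\<theta> \<in> hom G (?C \<times>\<times> ?C)"
  proof (rule homI)
    fix g assume "g \<in> carrier G"
    then obtain i j z where g: "g = x [^] (i::int) \<otimes> y [^] (j::int) \<otimes> z" and z: "z \<in> ?Z"
      using carrier_span by blast
    show "\<theta> g \<in> carrier (?C \<times>\<times> ?C)" unfolding g \<theta>[OF z] using p0 by (simp add: carrier_integer_mod_group)
    fix h assume "h \<in> carrier G"
    then obtain k l w where h: "h = x [^] (k::int) \<otimes> y [^] (l::int) \<otimes> w" and w: "w \<in> ?Z"
      using carrier_span by blast
    have "c [^] (- (j * k)) \<otimes> z \<otimes> w \<in> ?Z"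
      using z w center_int_pow[OF c_center] by (simp add: subgroup.m_closed[OF group_center_subgroup])
    then show "\<theta> (g \<otimes> h) = \<theta> g \<otimes>\<^bsub>?C \<times>\<times> ?C\<^esub> \<theta> h"
      unfolding g h mult_form[OF z w] by (simp add: \<theta> z w mod_add_eq)
  qed
  then interpret \<theta>: group_hom G "?C \<times>\<times> ?C" \<theta>
    by (intro group_hom.intro group_hom_axioms.intro is_group DirProd_group group_integer_mod_group)
  have "\<theta> ` carrier G = carrier (?C \<times>\<times> ?C)"
  proof
    show "\<theta> ` carrier G \<subseteq> carrier (?C \<times>\<times> ?C)" using \<theta>.hom_closed by blast
    show "carrier (?C \<times>\<times> ?C) \<subseteq> \<theta> ` carrier G"
    proof
      fix a assume "a \<in> carrier (?C \<times>\<times> ?C)"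
      then obtain i j where a: "a = (i, j)" "0 \<le> i" "i < int p" "0 \<le> j" "j < int p"
        using p0 by (auto simp: carrier_integer_mod_group)
      then have "a = \<theta> (x [^] i \<otimes> y [^] j \<otimes> \<one>)" by (simp only: \<theta>[OF one]) simp
      then show "a \<in> \<theta> ` carrier G" by (rule image_eqI) simp
    qed
  qed
  moreover have "kernel G (?C \<times>\<times> ?C) \<theta> = ?Z"
  proof (intro equalityI subsetI)
    fix g assume "g \<in> kernel G (?C \<times>\<times> ?C) \<theta>"
    then have g: "g \<in> carrier G" "\<theta> g = (0, 0)" by (auto simp: kernel_def)
    then obtain i j z where gf: "g = x [^] (i::int) \<otimes> y [^] (j::int) \<otimes> z" and z: "z \<in> ?Z"
      using carrier_span by blast
    then show "g \<in> ?Z" using g(2) \<theta>[OF z] form_center_iff[OF z] by (auto simp: mod_eq_0_iff_dvd)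
  next
    fix z assume z: "z \<in> ?Z"
    then have "z = x [^] (0::int) \<otimes> y [^] (0::int) \<otimes> z" using group_centerD(1) by simp
    then have "\<theta> z = (0, 0)" using \<theta>[OF z, of 0 0] by simp
    then show "z \<in> kernel G (?C \<times>\<times> ?C) \<theta>" using z group_centerD(1) by (simp add: kernel_def)
  qed
  ultimately show ?thesis using \<theta>.FactGroup_iso by simp
qed

end

section \<open>A generating pair from the quotient\<close>

context group
begin

text \<open>\<open>x\<close> and \<open>y\<close> are preimages of the standard basis under the
  composite \<open>q\<close> of the projection with the isomorphism. As the kernel of
  \<open>q\<close> is the center, centrality is checked by computing residues; the commutator is
  central because the target is abelian.\<close>

lemma center_quotient_pairI:
  assumes "prime p" "G Mod group_center G \<cong> integer_mod_group p \<times>\<times> integer_mod_group p"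
  shows "\<exists>x y. center_quotient_pair G x y p"
proof -
  let ?C = "integer_mod_group p" and ?Z = "group_center G"
  have Zsub: "subgroup ?Z G" by (rule group_center_subgroup)
  interpret Z: normal ?Z G by (rule central_subgroup_normal[OF Zsub subset_refl])
  obtain h where h: "h \<in> iso (G Mod ?Z) (?C \<times>\<times> ?C)" using assms(2) unfolding is_iso_def by blast
  have hh: "h \<in> hom (G Mod ?Z) (?C \<times>\<times> ?C)" and hb: "bij_betw h (carrier (G Mod ?Z)) (carrier (?C \<times>\<times> ?C))"
    using h by (auto simp: iso_def)
  have CC: "group (?C \<times>\<times> ?C)" by (intro DirProd_group group_integer_mod_group)
  define q where "q = h \<circ> (\<lambda>g. ?Z #> g)"
  have q: "q \<in> hom G (?C \<times>\<times> ?C)" unfolding q_def by (rule Group.hom_compose[OF Z.r_coset_hom_Mod hh])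
  then have q12: "fst \<circ> q \<in> hom G ?C" "snd \<circ> q \<in> hom G ?C" by (simp_all add: hom_pairwise)
  interpret q1: group_hom G ?C "fst \<circ> q"
    by (intro group_hom.intro group_hom_axioms.intro is_group group_integer_mod_group q12)
  interpret q2: group_hom G ?C "snd \<circ> q"
    by (intro group_hom.intro group_hom_axioms.intro is_group group_integer_mod_group q12)
  have p1: "p > 1" using assms(1) prime_gt_1_nat by blast
  have surj: "\<exists>g \<in> carrier G. q g = a" if "a \<in> carrier (?C \<times>\<times> ?C)" for a
  proof -
    have "a \<in> h ` carrier (G Mod ?Z)" using hb that by (simp add: bij_betw_def)
    then show ?thesis by (auto simp: q_def carrier_FactGroup)
  qed
  have h1: "h ?Z = (0, 0)"
    using hom_one[OF hh Z.factorgroup_is_group CC] by (simp add: FactGroup_def)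
  have ker: "g \<in> ?Z" if "g \<in> carrier G" "(fst \<circ> q) g = 0" "(snd \<circ> q) g = 0" for g
  proof -
    have "h (?Z #> g) = h ?Z" using that h1 by (auto simp: q_def prod_eq_iff)
    moreover have "?Z #> g \<in> carrier (G Mod ?Z)" using that(1) by (simp add: carrier_FactGroup)
    moreover have "?Z \<in> carrier (G Mod ?Z)"
      using Z.subgroup_in_rcosets[OF is_group] by (simp add: FactGroup_def)
    ultimately have "?Z #> g = ?Z" using hb by (auto simp: bij_betw_def dest: inj_onD)
    then show ?thesis using coset_join1 that(1) Zsub by blast
  qed
  obtain x where x: "x \<in> carrier G" "q x = (1, 0)"
    using surj[of "(1, 0)"] p1 by (auto simp: carrier_integer_mod_group)
  obtain y where y: "y \<in> carrier G" "q y = (0, 1)"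
    using surj[of "(0, 1)"] p1 by (auto simp: carrier_integer_mod_group)
  have x1: "(fst \<circ> q) x = 1" "(snd \<circ> q) x = 0" and y1: "(fst \<circ> q) y = 0" "(snd \<circ> q) y = 1"
    using x y by simp_all
  have qinv: "(fst \<circ> q) (inv g) = (- (fst \<circ> q) g) mod int p"
    "(snd \<circ> q) (inv g) = (- (snd \<circ> q) g) mod int p" if "g \<in> carrier G" for g
    using that q1.hom_closed[OF that] q2.hom_closed[OF that] q1.hom_inv[OF that] q2.hom_inv[OF that] by simp_all
  have qpow: "(fst \<circ> q) (g [^] (k::int)) = (k * (fst \<circ> q) g) mod int p"
    "(snd \<circ> q) (g [^] (k::int)) = (k * (snd \<circ> q) g) mod int p" if "g \<in> carrier G" for g k
    using that q1.hom_int_pow[OF that] q2.hom_int_pow[OF that] by (simp_all add: int_pow_integer_mod_group)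
  have qmult: "(fst \<circ> q) (g \<otimes> g') = ((fst \<circ> q) g + (fst \<circ> q) g') mod int p"
    "(snd \<circ> q) (g \<otimes> g') = ((snd \<circ> q) g + (snd \<circ> q) g') mod int p"
    if "g \<in> carrier G" "g' \<in> carrier G" for g g'
    using q1.hom_mult[OF that] q2.hom_mult[OF that] by simp_all
  have "inv\<^bsub>?C\<^esub> 1 = (- 1) mod int p" using p1 by (intro inv_integer_mod_group) simp
  note qs = qinv qpow qmult x1 y1 this
  have comm: "inv x \<otimes> inv y \<otimes> x \<otimes> y \<in> ?Z"
  proof (rule ker)
    show "inv x \<otimes> inv y \<otimes> x \<otimes> y \<in> carrier G" using x y by simp
    show "(fst \<circ> q) (inv x \<otimes> inv y \<otimes> x \<otimes> y) = 0" "(snd \<circ> q) (inv x \<otimes> inv y \<otimes> x \<otimes> y) = 0"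
      using x(1) y(1) by (simp_all add: qs mod_simps del: o_apply)
  qed
  interpret P: central_commutator G x y using x(1) y(1) comm by unfold_locales
  \<comment> \<open>With the components of \<open>q g\<close> as exponents, \<open>x^i y^j\<close>
    has the same image as \<open>g\<close> and so differs from it by a central element.\<close>
  have span: "carrier G \<subseteq> {x [^] (i::int) \<otimes> y [^] (j::int) \<otimes> z | i j z. z \<in> ?Z}"
  proof
    fix g assume g: "g \<in> carrier G"
    let ?i = "(fst \<circ> q) g" and ?j = "(snd \<circ> q) g"
    have ij: "?i mod int p = ?i" "?j mod int p = ?j"
      using q1.hom_closed[OF g] q2.hom_closed[OF g] p1 by (auto simp: carrier_integer_mod_group)
    let ?u = "x [^] ?i \<otimes> y [^] ?j"
    have u: "?u \<in> carrier G" by simp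
    have "inv ?u \<otimes> g \<in> ?Z"
    proof (rule ker)
      show "inv ?u \<otimes> g \<in> carrier G" using g by simp
      have "(fst \<circ> q) ?u = ?i" "(snd \<circ> q) ?u = ?j"
        using x(1) y(1) ij by (simp_all add: qs del: o_apply)
      then show "(fst \<circ> q) (inv ?u \<otimes> g) = 0" "(snd \<circ> q) (inv ?u \<otimes> g) = 0"
        using u g qmult[of "inv ?u" g] qinv[OF u] by (simp_all add: mod_simps del: o_apply)
    qed
    moreover have "g = ?u \<otimes> (inv ?u \<otimes> g)" using u g by (simp flip: m_assoc)
    ultimately show "g \<in> {x [^] (i::int) \<otimes> y [^] (j::int) \<otimes> z | i j z. z \<in> ?Z}" by blast
  qed
  \<comment> \<open>If \<open>x\<close> and \<open>y\<close> commuted, \<open>x\<close> would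
    commute with every \<open>x^i y^j z\<close> and be central, against
    \<open>q x = (1, 0)\<close>.\<close>
  have ne: "inv x \<otimes> inv y \<otimes> x \<otimes> y \<noteq> \<one>"
  proof
    assume "inv x \<otimes> inv y \<otimes> x \<otimes> y = \<one>"
    then have c1: "P.c = \<one>" by (simp add: P.c_def)
    have one: "\<one> \<in> ?Z" using subgroup.one_closed[OF Zsub] .
    have "x \<in> ?Z" unfolding group_center_def
    proof (safe intro!: x(1))
      fix g assume "g \<in> carrier G"
      then obtain i j z where g: "g = x [^] (i::int) \<otimes> y [^] (j::int) \<otimes> z" and z: "z \<in> ?Z"
        using span by blast
      have "(x [^] (1::int) \<otimes> y [^] (0::int) \<otimes> \<one>) \<otimes> g = g \<otimes> (x [^] (1::int) \<otimes> y [^] (0::int) \<otimes> \<one>)"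
        unfolding g P.mult_form[OF one z] P.mult_form[OF z one]
        using group_centerD(1)[OF z] by (simp add: c1 add.commute)
      then show "x \<otimes> g = g \<otimes> x" by simp
    qed
    then have "q x = h ?Z" using coset_join2[OF x(1) Zsub] by (simp add: q_def)
    then show False using x(2) h1 by simp
  qed
  have xp: "x [^] p \<in> ?Z" "y [^] p \<in> ?Z"
    using x(1) y(1) qpow[of x "int p"] qpow[of y "int p"] x1 y1
    by (auto intro!: ker simp: int_pow_int simp del: o_apply)
  have "center_quotient_pair G x y p"
    using assms(1) ne xp span group_centerD(1) by unfold_locales auto
  then show ?thesis by blast
qed

section \<open>Direct products with a central factor\<close>

lemma commute_of_normal:
  assumes "H \<lhd> G" "K \<lhd> G" "H \<inter> K = {\<one>}" "h \<in> H" "k \<in> K"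
  shows "h \<otimes> k = k \<otimes> h"
proof -
  interpret H: normal H G by fact
  interpret K: normal K G by fact
  have C: "h \<in> carrier G" "k \<in> carrier G" using assms(4,5) by auto
  let ?c = "h \<otimes> k \<otimes> inv h \<otimes> inv k"
  have "?c = h \<otimes> (k \<otimes> inv h \<otimes> inv k)" using C by (simp add: m_assoc)
  moreover have "h \<otimes> (k \<otimes> inv h \<otimes> inv k) \<in> H"
    using assms(4) C by (intro H.m_closed H.inv_op_closed2) auto
  moreover have "?c \<in> K" using assms(5) C by (intro K.m_closed K.inv_op_closed2) auto
  ultimately have "?c = \<one>" using assms(3) by auto
  then have "h \<otimes> k = inv (inv h \<otimes> inv k)" using C by (metis inv_closed inv_equality inv_inv m_assoc m_closed)
  then show ?thesis using C by (simp add: inv_mult_group)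
qed

lemma internal_direct_product_sym:
  "internal_direct_product G H K \<Longrightarrow> internal_direct_product G K H"
  unfolding internal_direct_product_def
  using commut_normal[OF normal_imp_subgroup] by (metis Int_commute)

text \<open>Normality of \<open>D\<close> comes for free: conjugation by
  \<open>d \<otimes> a\<close> with central \<open>a\<close> acts as conjugation by
  \<open>d\<close>.\<close>

lemma internal_direct_productI_central:
  assumes D: "subgroup D G" and A: "subgroup A G" "A \<subseteq> group_center G"
    and int: "D \<inter> A \<subseteq> {\<one>}" and gen: "carrier G \<subseteq> D <#> A"
  shows "internal_direct_product G D A"
  unfolding internal_direct_product_def
proof (intro conjI)
  show "A \<lhd> G" by (rule central_subgroup_normal[OF A])
  show "D \<inter> A = {\<one>}" using int subgroup.one_closed[OF D] subgroup.one_closed[OF A(1)] by blast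
  show "D <#> A = carrier G"
    using gen setmult_subset_G[OF subgroup.subset[OF D] subgroup.subset[OF A(1)]] by blast
  show "D \<lhd> G" unfolding normal_inv_iff
  proof (intro conjI ballI D)
    fix g h assume "g \<in> carrier G" and h: "h \<in> D"
    then obtain d a where g: "g = d \<otimes> a" and d: "d \<in> D" and a: "a \<in> A"
      using gen unfolding set_mult_def by blast
    have C: "d \<in> carrier G" "a \<in> carrier G" "h \<in> carrier G"
      using d a h subgroup.mem_carrier[OF D] subgroup.mem_carrier[OF A(1)] by auto
    have "a \<otimes> h = h \<otimes> a" using group_centerD(2) A(2) a C by blast
    then have "g \<otimes> h \<otimes> inv g = d \<otimes> (h \<otimes> a) \<otimes> (inv a \<otimes> inv d)"
      unfolding g using C by (simp add: m_assoc inv_mult_group)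
    also have "\<dots> = d \<otimes> h \<otimes> inv d"
      using C by (simp add: m_assoc) (simp flip: m_assoc)
    finally show "g \<otimes> h \<otimes> inv g \<in> D"
      using d h D by (simp add: subgroup.m_closed subgroup.m_inv_closed)
  qed
qed

text \<open>Normal subgroups with trivial intersection commute elementwise, so an element central in
  \<open>D\<close> also commutes with \<open>A\<close>.\<close>

lemma group_center_factor:
  assumes "internal_direct_product G D A"
  shows "group_center (G\<lparr>carrier := D\<rparr>) = D \<inter> group_center G"
proof (intro equalityI subsetI)
  have D: "D \<lhd> G" and A: "A \<lhd> G" and int: "D \<inter> A = {\<one>}" and gen: "D <#> A = carrier G"
    using assms by (auto simp: internal_direct_product_def)
  fix z assume "z \<in> group_center (G\<lparr>carrier := D\<rparr>)"
  then have z: "z \<in> D" "\<And>d. d \<in> D \<Longrightarrow> z \<otimes> d = d \<otimes> z" by (auto simp: group_center_def)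
  have sub: "D \<subseteq> carrier G" "A \<subseteq> carrier G"
    using D A by (simp_all add: normal_imp_subgroup subgroup.subset)
  show "z \<in> D \<inter> group_center G" unfolding group_center_def
  proof (safe intro!: z(1))
    show "z \<in> carrier G" using z(1) sub by blast
    fix g assume "g \<in> carrier G"
    then obtain d a where g: "g = d \<otimes> a" and d: "d \<in> D" and a: "a \<in> A"
      using gen unfolding set_mult_def by blast
    have C: "d \<in> carrier G" "a \<in> carrier G" "z \<in> carrier G" using d a z(1) sub by auto
    have "z \<otimes> g = d \<otimes> z \<otimes> a" using z(2)[OF d] C g by (simp flip: m_assoc)
    also have "\<dots> = d \<otimes> (a \<otimes> z)" using commute_of_normal[OF D A int z(1) a] C by (simp add: m_assoc)
    finally show "z \<otimes> g = g \<otimes> z" using C g by (simp add: m_assoc)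
  qed
next
  fix z assume z: "z \<in> D \<inter> group_center G"
  have "D \<subseteq> carrier G"
    using assms by (simp add: internal_direct_product_def normal_imp_subgroup subgroup.subset)
  then show "z \<in> group_center (G\<lparr>carrier := D\<rparr>)"
    using z by (auto simp: group_center_def)
qed

text \<open>The decomposition results require a commutative group and are applied to the center as a
  group of its own; this reads their outcome back in \<open>G\<close>.\<close>

lemma splits_center:
  assumes "splits (G\<lparr>carrier := group_center G\<rparr>) R u R'"
  shows "splits G R u R'"
proof -
  let ?Z = "G\<lparr>carrier := group_center G\<rparr>"
  have u: "u \<in> group_center G" using assms by (simp add: splits_def)
  then have "u [^]\<^bsub>?Z\<^esub> (k::int) = u [^] k" for k
    using int_pow_consistent[OF group_center_subgroup] by metis
  then show ?thesis
    using assms u incl_subgroup[OF group_center_subgroup] group_centerD(1)[OF u]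
    unfolding splits_def by simp
qed

lemma ord_consistent:
  assumes "subgroup H G"
  shows "group.ord (G\<lparr>carrier := H\<rparr>) z = ord z"
proof -
  interpret H: group "G\<lparr>carrier := H\<rparr>" by (rule subgroup_imp_group[OF assms])
  show ?thesis by (simp add: H.ord_def ord_def nat_pow_consistent[of z _ H])
qed

end

section \<open>Central direct factors and the indecomposable case\<close>

context center_quotient_pair
begin

text \<open>Commutators do not see central factors. The freedom serves two purposes: projecting
  \<open>x\<close> and \<open>y\<close> into a direct factor, and cancelling \<open>p\<close>-th
  powers in \<open>x^p\<close> and \<open>y^p\<close>, since \<open>(x a)^p = x^p a^p\<close> for
  central \<open>a\<close>.\<close>

lemma center_shift:
  assumes a: "a \<in> group_center G" and b: "b \<in> group_center G"
  shows "center_quotient_pair G (x \<otimes> a) (y \<otimes> b) p"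
    and "inv (x \<otimes> a) \<otimes> inv (y \<otimes> b) \<otimes> (x \<otimes> a) \<otimes> (y \<otimes> b) = c"
proof -
  let ?x = "x \<otimes> a" and ?y = "y \<otimes> b"
  note ac = group_centerD[OF a] and bc = group_centerD[OF b]
  have C: "?x \<in> carrier G" "?y \<in> carrier G" using ac(1) bc(1) by auto
  have 1: "?x \<otimes> ?y = x \<otimes> y \<otimes> (a \<otimes> b)"
    using mult_form[OF a b, of 1 0 0 1] ac(1) bc(1) by simp
  have "?y \<otimes> ?x = x \<otimes> y \<otimes> (c [^] (- 1 :: int) \<otimes> b \<otimes> a)"
    using mult_form[OF b a, of 0 1 1 0] ac(1) bc(1) by simp
  also have "c [^] (- 1 :: int) \<otimes> b \<otimes> a = inv c \<otimes> (a \<otimes> b)"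
    using ac(2)[OF bc(1)] ac(1) bc(1) by (simp add: m_assoc int_pow_neg)
  also have "\<dots> = a \<otimes> b \<otimes> inv c"
    using ac(1) bc(1) subgroup.m_inv_closed[OF group_center_subgroup c_center]
    by (intro group_centerD(2)) auto
  finally have "?y \<otimes> ?x \<otimes> c = ?x \<otimes> ?y" using ac(1) bc(1) 1 by (simp add: m_assoc)
  then have "c = inv (?y \<otimes> ?x) \<otimes> (?x \<otimes> ?y)" using C by (metis c_closed inv_closed inv_solve_left m_closed)
  then show comm: "inv ?x \<otimes> inv ?y \<otimes> ?x \<otimes> ?y = c" using C by (simp add: inv_mult_group m_assoc)
  have pow: "?x [^] p \<in> group_center G" "?y [^] p \<in> group_center G"
  proof -
    have "?x [^] p = x [^] p \<otimes> a [^] p" using ac by (simp add: pow_mult_distrib)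
    then show "?x [^] p \<in> group_center G"
      using pow_central(1) center_int_pow[OF a, of "int p"]
      by (simp add: int_pow_int subgroup.m_closed[OF group_center_subgroup])
    have "?y [^] p = y [^] p \<otimes> b [^] p" using bc by (simp add: pow_mult_distrib)
    then show "?y [^] p \<in> group_center G"
      using pow_central(2) center_int_pow[OF b, of "int p"]
      by (simp add: int_pow_int subgroup.m_closed[OF group_center_subgroup])
  qed
  have "carrier G \<subseteq> {?x [^] (i::int) \<otimes> ?y [^] (j::int) \<otimes> z | i j z. z \<in> group_center G}"
  proof
    fix g assume "g \<in> carrier G"
    then obtain i j z where g: "g = x [^] (i::int) \<otimes> y [^] (j::int) \<otimes> z" and z: "z \<in> group_center G"
      using carrier_span by blast
    let ?v = "a [^] i \<otimes> b [^] j"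
    have v: "?v \<in> group_center G"
      using center_int_pow a b by (simp add: subgroup.m_closed[OF group_center_subgroup])
    have vc: "?v \<in> carrier G" "z \<in> carrier G" using group_centerD(1) v z by auto
    have "?x [^] i = x [^] i \<otimes> a [^] i" "?y [^] j = y [^] j \<otimes> b [^] j"
      using ac bc by (simp_all add: int_pow_mult_distrib)
    then have "?x [^] i \<otimes> ?y [^] j = x [^] i \<otimes> y [^] j \<otimes> ?v"
      using mult_form[OF center_int_pow[OF a] center_int_pow[OF b], of i 0 i 0 j j] ac(1) bc(1) by simp
    then have "g = ?x [^] i \<otimes> ?y [^] j \<otimes> (inv ?v \<otimes> z)"
      unfolding g using vc ac(1) bc(1) by (simp add: m_assoc) (simp flip: m_assoc)
    moreover have "inv ?v \<otimes> z \<in> group_center G"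
      using v z group_center_subgroup by (simp add: subgroup.m_closed subgroup.m_inv_closed)
    ultimately show "g \<in> {?x [^] (i::int) \<otimes> ?y [^] (j::int) \<otimes> z | i j z. z \<in> group_center G}" by blast
  qed
  then show "center_quotient_pair G ?x ?y p"
    using C comm c_center c_ne_one prime pow group_centerD(1) by unfold_locales auto
qed

text \<open>If \<open>g = x^i y^j z\<close> lies in \<open>D\<close>, then so does \<open>z\<close>,
  because \<open>x\<close> and \<open>y\<close> do; the assumption on the centers makes
  \<open>z\<close> an element of the center of \<open>D\<close>.\<close>

lemma restrict_subgroup:
  assumes D: "subgroup D G" "x \<in> D" "y \<in> D" "group_center (G\<lparr>carrier := D\<rparr>) = D \<inter> group_center G"
  shows "center_quotient_pair (G\<lparr>carrier := D\<rparr>) x y p"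
proof -
  interpret D: group "G\<lparr>carrier := D\<rparr>" by (rule subgroup_imp_group[OF D(1)])
  have pow: "x [^]\<^bsub>G\<lparr>carrier := D\<rparr>\<^esub> (i::int) = x [^] i" "y [^]\<^bsub>G\<lparr>carrier := D\<rparr>\<^esub> (i::int) = y [^] i" for i
    using int_pow_consistent[OF D(1)] D(2,3) by metis+
  have npow: "g [^]\<^bsub>G\<lparr>carrier := D\<rparr>\<^esub> (i::nat) = g [^] i" for g i using nat_pow_consistent by metis
  have npD: "g [^] (i::nat) \<in> D" if "g \<in> D" for g i
    using subgroup_int_pow_closed[OF D(1) that] by (metis int_pow_int)
  have cD: "inv x \<otimes> inv y \<otimes> x \<otimes> y \<in> D"
    using D(1-3) by (simp add: subgroup.m_closed subgroup.m_inv_closed)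
  have "D \<subseteq> {x [^] (i::int) \<otimes> y [^] (j::int) \<otimes> z | i j z. z \<in> D \<inter> group_center G}"
  proof
    fix g assume g: "g \<in> D"
    then obtain i j z where gf: "g = x [^] (i::int) \<otimes> y [^] (j::int) \<otimes> z" and z: "z \<in> group_center G"
      using carrier_span subgroup.mem_carrier[OF D(1)] by blast
    have "x [^] i \<otimes> y [^] j \<in> D"
      using D(1-3) by (intro subgroup.m_closed subgroup_int_pow_closed)
    moreover have "z = inv (x [^] i \<otimes> y [^] j) \<otimes> g"
      using gf group_centerD(1)[OF z] by (subst inv_solve_left) auto
    ultimately have "z \<in> D" using g D(1) by (simp add: subgroup.m_closed subgroup.m_inv_closed)
    then show "g \<in> {x [^] (i::int) \<otimes> y [^] (j::int) \<otimes> z | i j z. z \<in> D \<inter> group_center G}"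
      using gf z by blast
  qed
  moreover have "{x [^] (i::int) \<otimes> y [^] (j::int) \<otimes> z | i j z. z \<in> D \<inter> group_center G} \<subseteq> D"
    using D(1-3) by (auto intro!: subgroup.m_closed[OF D(1)] subgroup_int_pow_closed[OF D(1)])
  ultimately have span: "D = {x [^] (i::int) \<otimes> y [^] (j::int) \<otimes> z | i j z. z \<in> D \<inter> group_center G}" by blast
  show ?thesis
  proof (intro center_quotient_pair.intro central_commutator.intro central_commutator_axioms.intro
      center_quotient_pair_axioms.intro D.is_group prime)
    show "carrier (G\<lparr>carrier := D\<rparr>) = {x [^]\<^bsub>G\<lparr>carrier := D\<rparr>\<^esub> (i::int) \<otimes>\<^bsub>G\<lparr>carrier := D\<rparr>\<^esub>
        y [^]\<^bsub>G\<lparr>carrier := D\<rparr>\<^esub> (j::int) \<otimes>\<^bsub>G\<lparr>carrier := D\<rparr>\<^esub> z | i j z. z \<in> group_center (G\<lparr>carrier := D\<rparr>)}"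
      unfolding pow D(4) using span by simp
  qed (use D cD npow npD pow_central commutator_central noncommuting in \<open>simp_all add: npow\<close>)
qed

text \<open>This is the noetherian property of the center; the maximal choice of a central factor
  and the finite generation of both factors of \<open>G\<close> rest on it.\<close>

lemma central_subgroup_finitely_generated:
  assumes "finitely_generated_group G" "subgroup A G" "A \<subseteq> group_center G"
  shows "\<exists>T. finite T \<and> T \<subseteq> A \<and> generate G T = A"
proof -
  let ?Z = "G\<lparr>carrier := group_center G\<rparr>"
  interpret Z: comm_group ?Z by (rule group_center_comm_group)
  obtain T where T: "finite T" "T \<subseteq> group_center G" "generate G T = group_center G"
    using center_finitely_generated[OF assms(1)] by blast
  have "generate ?Z T = group_center G"
    using generate_consistent[OF T(2) group_center_subgroup] T(3) by simp
  then obtain S where S: "finite S" "S \<subseteq> A" "generate ?Z S = A"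
    using Z.subgroup_finitely_generated[of T A] T assms(3)
      subgroup_incl[OF assms(2) group_center_subgroup assms(3)] by auto
  moreover have "generate ?Z S = generate G S"
    using S(2) assms(3) by (intro generate_consistent group_center_subgroup) blast
  ultimately show ?thesis by auto
qed

text \<open>A maximal central direct factor exists because an ascending union of central subgroups is
  finitely generated, hence equal to one of them.\<close>

lemma exists_indecomposable_factor:
  assumes fg: "finitely_generated_group G"
  shows "\<exists>D A. internal_direct_product G D A \<and> A \<subseteq> group_center G \<and>
    indecomposable_group (G\<lparr>carrier := D\<rparr>)"
proof -
  let ?Z = "group_center G"
  define \<A> where "\<A> = {A. subgroup A G \<and> A \<subseteq> ?Z \<and> (\<exists>D. internal_direct_product G D A)}"
  have "\<exists>A\<in>\<A>. \<forall>X\<in>\<A>. A \<subseteq> X \<longrightarrow> X = A"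
  proof (rule subset_Zorn_nonempty)
    \<comment> \<open>The decomposition of \<open>G\<close> as \<open>G\<close> times the trivial
      group makes the family nonempty.\<close>
    have "carrier G <#> {\<one>} = carrier G" by (auto simp: set_mult_def)
    then have "internal_direct_product G (carrier G) {\<one>}"
      using subgroup.one_closed[OF group_center_subgroup]
      by (intro internal_direct_productI_central subgroup_self triv_subgroup) auto
    then have "{\<one>} \<in> \<A>"
      unfolding \<A>_def using triv_subgroup subgroup.one_closed[OF group_center_subgroup] by blast
    then show "\<A> \<noteq> {}" by blast
    fix \<C> assume ne: "\<C> \<noteq> {}" and chain: "subset.chain \<A> \<C>"
    have mem: "subgroup A G" "A \<subseteq> ?Z" "A \<in> \<A>" if "A \<in> \<C>" for A
      using chain that unfolding subset.chain_def \<A>_def by auto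
    have U: "subgroup (\<Union>\<C>) G"
    proof
      show "\<Union>\<C> \<subseteq> carrier G" using subgroup.subset[OF mem(1)] by blast
      show "\<one> \<in> \<Union>\<C>" using ne subgroup.one_closed[OF mem(1)] by blast
      show "inv a \<in> \<Union>\<C>" if "a \<in> \<Union>\<C>" for a
        using that subgroup.m_inv_closed[OF mem(1)] by blast
      fix a b assume "a \<in> \<Union>\<C>" "b \<in> \<Union>\<C>"
      then obtain A B where AB: "A \<in> \<C>" "a \<in> A" "B \<in> \<C>" "b \<in> B" by blast
      then have "A \<subseteq> B \<or> B \<subseteq> A" using chain unfolding subset_chain_def by blast
      then show "a \<otimes> b \<in> \<Union>\<C>"
        using AB subgroup.m_closed[OF mem(1)[OF AB(1)]] subgroup.m_closed[OF mem(1)[OF AB(3)]] by blast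
    qed
    have UZ: "\<Union>\<C> \<subseteq> ?Z" using mem(2) by blast
    obtain T where T: "finite T" "T \<subseteq> \<Union>\<C>" "generate G T = \<Union>\<C>"
      using central_subgroup_finitely_generated[OF fg U UZ] by blast
    obtain A where A: "A \<in> \<C>" "T \<subseteq> A"
      using finite_subset_Union_chain[OF T(1,2) ne chain] .
    then have "\<Union>\<C> \<subseteq> A" using generate_subgroup_incl[OF A(2) mem(1)[OF A(1)]] T(3) by simp
    then have "\<Union>\<C> = A" using A(1) by blast
    then show "\<Union>\<C> \<in> \<A>" using mem(3)[OF A(1)] by simp
  qed
  then obtain A where A: "A \<in> \<A>" and max: "\<And>X. X \<in> \<A> \<Longrightarrow> A \<subseteq> X \<Longrightarrow> X = A" by blast
  obtain D where D: "internal_direct_product G D A" and Asub: "subgroup A G" and AZ: "A \<subseteq> ?Z"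
    using A unfolding \<A>_def by blast
  have Dn: "D \<lhd> G" and DA: "D \<inter> A = {\<one>}" and gen: "D <#> A = carrier G"
    using D by (auto simp: internal_direct_product_def)
  have Dsub: "subgroup D G" using Dn by (rule normal_imp_subgroup)
  interpret D: group "G\<lparr>carrier := D\<rparr>" by (rule subgroup_imp_group[OF Dsub])
  \<comment> \<open>If a direct factor \<open>K\<close> of \<open>D\<close> is central in
    \<open>G\<close>, then \<open>K <#> A\<close> is again a central direct factor, with complement
    \<open>H\<close>. Maximality gives \<open>K \<subseteq> A\<close>, and \<open>D\<close> meets
    \<open>A\<close> trivially.\<close>
  have central: "K = {\<one>}"
    if HK: "internal_direct_product (G\<lparr>carrier := D\<rparr>) H K" and KZ: "K \<subseteq> ?Z" for H K
  proof -
    have n: "H \<lhd> G\<lparr>carrier := D\<rparr>" "K \<lhd> G\<lparr>carrier := D\<rparr>" and int: "H \<inter> K = {\<one>}"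
      and HKD: "H <#> K = D"
      using HK by (auto simp: internal_direct_product_def)
    have sub: "subgroup H G" "subgroup K G" "H \<subseteq> D" "K \<subseteq> D"
      using n[THEN normal_imp_subgroup, THEN incl_subgroup[OF Dsub]]
        n[THEN normal_imp_subgroup, THEN subgroup.subset] by simp_all
    have KA: "subgroup (K <#> A) G"
      by (rule mult_norm_subgroup[OF central_subgroup_normal[OF sub(2) KZ] Asub])
    have KAZ: "K <#> A \<subseteq> ?Z"
      using KZ AZ subgroup.m_closed[OF group_center_subgroup] unfolding set_mult_def by blast
    have "H \<inter> (K <#> A) \<subseteq> {\<one>}"
    proof
      fix h assume h: "h \<in> H \<inter> (K <#> A)"
      then obtain k a where ka: "h = k \<otimes> a" "k \<in> K" "a \<in> A" unfolding set_mult_def by blast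
      have C: "k \<in> carrier G" "a \<in> carrier G"
        using ka subgroup.mem_carrier[OF sub(2)] subgroup.mem_carrier[OF Asub] by auto
      have "a = inv k \<otimes> h" using ka(1) C by (simp flip: m_assoc)
      then have "a \<in> D"
        using h ka(2) sub(3,4) subgroup.m_closed[OF Dsub] subgroup.m_inv_closed[OF Dsub] by blast
      then have "a = \<one>" using DA ka(3) by blast
      then show "h \<in> {\<one>}" using ka C h int by auto
    qed
    moreover have "H <#> (K <#> A) = carrier G"
      using set_mult_assoc[OF sub(1,2)[THEN subgroup.subset] subgroup.subset[OF Asub]] HKD gen by simp
    ultimately have "internal_direct_product G H (K <#> A)"
      by (intro internal_direct_productI_central sub(1) KA KAZ) auto
    then have "K <#> A \<in> \<A>" unfolding \<A>_def using KA KAZ by blast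
    moreover have "A \<subseteq> K <#> A"
    proof
      fix a assume "a \<in> A"
      then have "a = \<one> \<otimes> a" using subgroup.mem_carrier[OF Asub] by simp
      then show "a \<in> K <#> A" unfolding set_mult_def
        using subgroup.one_closed[OF sub(2)] \<open>a \<in> A\<close> by blast
    qed
    ultimately have eq: "K <#> A = A" by (rule max)
    have "K \<subseteq> A"
    proof
      fix k assume "k \<in> K"
      then have "k = k \<otimes> \<one>" using subgroup.mem_carrier[OF sub(2)] by simp
      then have "k \<in> K <#> A" unfolding set_mult_def
        using subgroup.one_closed[OF Asub] \<open>k \<in> K\<close> by blast
      then show "k \<in> A" using eq by simp
    qed
    then show ?thesis using sub(4) DA subgroup.one_closed[OF sub(2)] by blast
  qed
  have "indecomposable_group (G\<lparr>carrier := D\<rparr>)"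
    unfolding indecomposable_group_def
  proof (intro conjI allI impI D.is_group)
    fix H K assume HK: "internal_direct_product (G\<lparr>carrier := D\<rparr>) H K"
    have n: "H \<lhd> G\<lparr>carrier := D\<rparr>" "K \<lhd> G\<lparr>carrier := D\<rparr>" and int: "H \<inter> K = {\<one>}"
      and HKD: "H <#> K = D"
      using HK by (auto simp: internal_direct_product_def)
    have sub: "H \<subseteq> carrier G" "K \<subseteq> carrier G"
      using n[THEN normal_imp_subgroup, THEN incl_subgroup[OF Dsub], THEN subgroup.subset] .
    have hk: "h \<otimes> k = k \<otimes> h" if "h \<in> H" "k \<in> K" for h k
      using D.commute_of_normal[OF n _ that] int by simp
    \<comment> \<open>If \<open>H\<close> contains a noncommuting pair, \<open>K\<close> centralizes
      it and is therefore central. If \<open>H\<close> is abelian, it commutes with itself, with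
      \<open>K\<close> and with \<open>A\<close>, hence is central.\<close>
    have "H \<subseteq> ?Z \<or> K \<subseteq> ?Z"
    proof (cases "\<exists>a\<in>H. \<exists>b\<in>H. a \<otimes> b \<noteq> b \<otimes> a")
      case True
      then obtain a b where ab: "a \<in> H" "b \<in> H" "a \<otimes> b \<noteq> b \<otimes> a" by blast
      have "k \<in> ?Z" if "k \<in> K" for k
        using ab that hk[OF ab(1) that] hk[OF ab(2) that] sub
        by (intro centralizer_of_noncommuting[of a b k]) auto
      then show ?thesis by blast
    next
      case False
      have "h \<in> ?Z" if h: "h \<in> H" for h
        unfolding group_center_def
      proof (safe)
        show hc: "h \<in> carrier G" using h sub by blast
        fix g assume "g \<in> carrier G"
        then obtain d a where g: "g = d \<otimes> a" "d \<in> D" "a \<in> A" using gen unfolding set_mult_def by blast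
        obtain b k where d: "d = b \<otimes> k" "b \<in> H" "k \<in> K" using g(2) HKD unfolding set_mult_def by blast
        have C: "b \<in> carrier G" "k \<in> carrier G" "a \<in> carrier G"
          using d g sub subgroup.mem_carrier[OF Asub] by auto
        have "h \<otimes> b = b \<otimes> h" using False h d(2) by blast
        then have "h \<otimes> g = b \<otimes> (h \<otimes> k) \<otimes> a" unfolding g d using C hc by (simp flip: m_assoc)
        also have "\<dots> = b \<otimes> k \<otimes> (h \<otimes> a)" using hk[OF h d(3)] C hc by (simp add: m_assoc)
        also have "h \<otimes> a = a \<otimes> h" using group_centerD(2)[of a h] AZ g(3) hc by auto
        finally show "h \<otimes> g = g \<otimes> h" unfolding g d using C hc by (simp add: m_assoc)
      qed
      then show ?thesis by blast
    qed
    then show "H = {\<one>\<^bsub>G\<lparr>carrier := D\<rparr>\<^esub>} \<or> K = {\<one>\<^bsub>G\<lparr>carrier := D\<rparr>\<^esub>}"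
      using central[OF HK] central[OF D.internal_direct_product_sym[OF HK]] by auto
  qed
  then show ?thesis using D AZ by blast
qed

text \<open>A new pair \<open>a\<close>, \<open>b\<close> appears because \<open>x\<close> and
  \<open>y\<close> are fixed before the center is decomposed: the decomposition is adapted to their
  \<open>p\<close>-th powers, and the surplus \<open>p\<close>-th powers found there are then
  removed by central factors, which leave the commutator unchanged.\<close>

lemma indecomposable_structure:
  assumes fg: "finitely_generated_group G" and indec: "indecomposable_group G"
  shows "\<exists>a b t z\<^sub>2 z\<^sub>3 m. center_quotient_pair G a b p \<and>
    direct_product_of_three_cyclic (G\<lparr>carrier := group_center G\<rparr>) t z\<^sub>2 z\<^sub>3 \<and>
    ord t = p ^ Suc m \<and> inv a \<otimes> inv b \<otimes> a \<otimes> b = t [^] (p ^ m) \<and>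
    p_power_or_infinite_order G p z\<^sub>2 \<and> p_power_or_infinite_order G p z\<^sub>3 \<and>
    a [^] p \<in> generate G {t} <#> generate G {z\<^sub>2}"
proof -
  let ?C = "group_center G"
  let ?Z = "G\<lparr>carrier := ?C\<rparr>"
  note Csub = group_center_subgroup
  interpret Z: comm_group ?Z by (rule group_center_comm_group)
  have ordZ: "Z.ord z = ord z" for z by (rule ord_consistent[OF Csub])
  have powZ: "z [^]\<^bsub>?Z\<^esub> (n::nat) = z [^] n" for z n using nat_pow_consistent by metis
  have ipowZ: "z [^]\<^bsub>?Z\<^esub> (n::int) = z [^] n" if "z \<in> ?C" for z n
    using int_pow_consistent[OF Csub that] by metis
  have ptypeZ: "p_power_or_infinite_order ?Z p z = p_power_or_infinite_order G p z" for z
    by (simp add: p_power_or_infinite_order_def ordZ)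
  obtain T where T: "finite T" "T \<subseteq> ?C" "generate G T = ?C"
    using center_finitely_generated[OF fg] by blast
  have "primary_sum ?Z p (generate ?Z T)"
    using Z.primary_sum_generate[OF prime T(1)] T(2) by simp
  then have prim: "primary_sum ?Z p ?C"
    using generate_consistent[OF T(2) Csub] T(3) by simp
  obtain t R\<^sub>1 m where t: "splits ?Z ?C t R\<^sub>1" "primary_sum ?Z p R\<^sub>1" "ord t = p ^ Suc m" "c = t [^] (p ^ m)"
    using Z.primary_sum_root_split[OF prime prim c_center] c_ne_one c_pow_p
    unfolding powZ ordZ by auto
  note S1 = splits_center[OF t(1)] and Z1 = Z.splitsD[OF t(1)]
  obtain i b\<^sub>1 where xp: "x [^] p = t [^] (i::int) \<otimes> b\<^sub>1" and b1: "b\<^sub>1 \<in> R\<^sub>1"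
    using S1 pow_central(1) unfolding splits_def by auto
  obtain i' b\<^sub>1' where yp: "y [^] p = t [^] (i'::int) \<otimes> b\<^sub>1'" and b1': "b\<^sub>1' \<in> R\<^sub>1"
    using S1 pow_central(2) unfolding splits_def by auto
  obtain z\<^sub>2 R\<^sub>2 w and f :: int where z2: "splits ?Z R\<^sub>1 z\<^sub>2 R\<^sub>2" "primary_sum ?Z p R\<^sub>2"
      "p_power_or_infinite_order G p z\<^sub>2" "w \<in> R\<^sub>1" "b\<^sub>1 = z\<^sub>2 [^]\<^bsub>?Z\<^esub> f \<otimes> w [^] p"
    using Z.primary_sum_pth_power_split[OF prime t(2) b1] unfolding ptypeZ powZ by auto
  note S2 = splits_center[OF z2(1)] and Z2 = Z.splitsD[OF z2(1)]
  obtain j b\<^sub>2 where b2: "b\<^sub>1' = z\<^sub>2 [^] (j::int) \<otimes> b\<^sub>2" "b\<^sub>2 \<in> R\<^sub>2"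
    using S2 b1' unfolding splits_def by auto
  obtain z\<^sub>3 R\<^sub>3 v and e :: int where z3: "splits ?Z R\<^sub>2 z\<^sub>3 R\<^sub>3"
      "p_power_or_infinite_order G p z\<^sub>3" "v \<in> R\<^sub>2" "b\<^sub>2 = z\<^sub>3 [^]\<^bsub>?Z\<^esub> e \<otimes> v [^] p"
    using Z.primary_sum_pth_power_split[OF prime z2(2) b2(2)] unfolding ptypeZ powZ by auto
  note S3 = splits_center[OF z3(1)] and Z3 = Z.splitsD[OF z3(1)]
  have sub: "subgroup R\<^sub>1 G" "subgroup R\<^sub>2 G" "subgroup R\<^sub>3 G"
    using S1 S2 S3 by (simp_all add: splits_def)
  have zc: "t \<in> ?C" "z\<^sub>2 \<in> ?C" "z\<^sub>3 \<in> ?C" using Z1(3) Z2(3) Z3(3) by simp_all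
  have RC: "R\<^sub>3 \<subseteq> R\<^sub>2" "R\<^sub>2 \<subseteq> R\<^sub>1" "R\<^sub>1 \<subseteq> ?C" using Z1(5) Z2(5) Z3(5) by simp_all
  have wc: "w \<in> ?C" "v \<in> ?C" using z2(4) z3(3) RC by auto
  have car: "t \<in> carrier G" "z\<^sub>2 \<in> carrier G" "z\<^sub>3 \<in> carrier G" "w \<in> carrier G" "v \<in> carrier G"
    using zc wc group_centerD(1) by auto
  have iw: "inv w \<in> ?C" "inv v \<in> ?C" using wc subgroup.m_inv_closed[OF Csub] by auto
  define a where "a = x \<otimes> inv w"
  define b where "b = y \<otimes> inv v"
  have pair: "center_quotient_pair G a b p" unfolding a_def b_def by (rule center_shift(1)[OF iw])
  interpret P: center_quotient_pair G a b p by (rule pair)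
  have Pc: "P.c = c" unfolding P.c_def unfolding a_def b_def by (rule center_shift(2)[OF iw])
  have ap: "a [^] p = t [^] i \<otimes> z\<^sub>2 [^] f"
  proof -
    have "a [^] p = x [^] p \<otimes> inv (w [^] p)"
      unfolding a_def using group_centerD[OF iw(1)] car by (simp add: pow_mult_distrib nat_pow_inv)
    also have "x [^] p = t [^] i \<otimes> z\<^sub>2 [^] f \<otimes> w [^] p"
      unfolding xp z2(5) using car ipowZ[OF zc(2)] by (simp add: m_assoc)
    finally show ?thesis using car by (simp add: m_assoc)
  qed
  have bp: "b [^] p = t [^] i' \<otimes> (z\<^sub>2 [^] j \<otimes> z\<^sub>3 [^] e)"
  proof -
    have "b [^] p = y [^] p \<otimes> inv (v [^] p)"
      unfolding b_def using group_centerD[OF iw(2)] car by (simp add: pow_mult_distrib nat_pow_inv)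
    also have "y [^] p = t [^] i' \<otimes> (z\<^sub>2 [^] j \<otimes> z\<^sub>3 [^] e) \<otimes> v [^] p"
      unfolding yp b2 z3(4) using car ipowZ[OF zc(3)] by (simp add: m_assoc)
    finally show ?thesis using car by (simp add: m_assoc)
  qed
  \<comment> \<open>The part of the center built from the three chosen factors. It contains
    \<open>c\<close>, \<open>a^p\<close> and \<open>b^p\<close>; therefore \<open>span N\<close> is
    a subgroup, and its central elements, having exponents divisible by \<open>p\<close>, all lie in
    \<open>N\<close>.\<close>
  define N where "N = {t [^] (k::int) \<otimes> (z\<^sub>2 [^] (l::int) \<otimes> z\<^sub>3 [^] (r::int)) | k l r. True}"
  have NI: "t [^] (k::int) \<otimes> (z\<^sub>2 [^] (l::int) \<otimes> z\<^sub>3 [^] (r::int)) \<in> N" for k l r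
    unfolding N_def by blast
  have NC: "N \<subseteq> ?C"
    unfolding N_def using center_int_pow[OF zc(1)] center_int_pow[OF zc(2)] center_int_pow[OF zc(3)]
    by (auto intro!: subgroup.m_closed[OF Csub])
  have "N = {t [^]\<^bsub>?Z\<^esub> (k::int) \<otimes>\<^bsub>?Z\<^esub> r | k r. r \<in> {z\<^sub>2 [^]\<^bsub>?Z\<^esub> (k::int) \<otimes>\<^bsub>?Z\<^esub> r | k r. r \<in>
      {z\<^sub>3 [^]\<^bsub>?Z\<^esub> (k::int) \<otimes>\<^bsub>?Z\<^esub> r | k r. r \<in> {\<one>\<^bsub>?Z\<^esub>}}}}"
    unfolding N_def ipowZ[OF zc(1)] ipowZ[OF zc(2)] ipowZ[OF zc(3)] using car by (auto; blast)
  then have "subgroup N ?Z"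
    using Z.cyclic_mult_subgroup[OF Z1(3) Z.cyclic_mult_subgroup[OF Z2(3)
      Z.cyclic_mult_subgroup[OF Z3(3) Z.triv_subgroup]]] by simp
  then have Nsub: "subgroup N G" by (rule incl_subgroup[OF Csub])
  have cN: "P.c \<in> N"
    using NI[of "int (p ^ m)" 0 0] car unfolding Pc t(4) by (simp add: int_pow_int del: of_nat_power)
  have apN: "a [^] p \<in> N" using NI[of i f 0] car ap by simp
  have bpN: "b [^] p \<in> N" using NI[of i' j e] bp by simp
  have Dsub: "subgroup (P.span N) G" by (rule P.span_subgroup[OF Nsub NC cN])
  have NR: "N \<inter> R\<^sub>3 \<subseteq> {\<one>}"
  proof
    fix n assume n: "n \<in> N \<inter> R\<^sub>3"
    then obtain k l r where nf: "n = t [^] (k::int) \<otimes> (z\<^sub>2 [^] (l::int) \<otimes> z\<^sub>3 [^] (r::int))"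
      unfolding N_def by blast
    have n2: "n \<in> R\<^sub>2" "n \<in> R\<^sub>1" using n RC by auto
    have zr: "z\<^sub>3 [^] r \<in> R\<^sub>2" using Z3(4) by (rule subgroup_int_pow_closed[OF sub(2)])
    have z2l: "z\<^sub>2 [^] l \<otimes> z\<^sub>3 [^] r \<in> R\<^sub>1"
      using Z2(4) Z3(4) RC by (intro subgroup.m_closed[OF sub(1)] subgroup_int_pow_closed[OF sub(1)]) auto
    have "t [^] k = n \<otimes> inv (z\<^sub>2 [^] l \<otimes> z\<^sub>3 [^] r)" unfolding nf using car by (simp add: m_assoc)
    then have "t [^] k \<in> R\<^sub>1"
      using n2 z2l sub(1) by (simp add: subgroup.m_closed subgroup.m_inv_closed)
    then have tk: "t [^] k = \<one>" using S1 unfolding splits_def by blast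
    then have "z\<^sub>2 [^] l = n \<otimes> inv (z\<^sub>3 [^] r)" unfolding nf using car by (simp add: m_assoc)
    then have "z\<^sub>2 [^] l \<in> R\<^sub>2"
      using n2 zr sub(2) by (simp add: subgroup.m_closed subgroup.m_inv_closed)
    then have "z\<^sub>2 [^] l = \<one>" using S2 unfolding splits_def by blast
    then have n3: "n = z\<^sub>3 [^] r" using nf tk car by simp
    then have "z\<^sub>3 [^] r = \<one>" using n S3 unfolding splits_def by blast
    then show "n \<in> {\<one>}" using n3 by simp
  qed
  have int: "P.span N \<inter> R\<^sub>3 \<subseteq> {\<one>}"
  proof
    fix g assume g: "g \<in> P.span N \<inter> R\<^sub>3"
    then obtain k l n where gf: "g = a [^] (k::int) \<otimes> b [^] (l::int) \<otimes> n" and n: "n \<in> N"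
      unfolding P.span_def by blast
    have "g \<in> ?C" using g RC by auto
    then have "int p dvd k" "int p dvd l" using P.form_center_iff[of n k l] n NC gf by auto
    then obtain k' l' where "k = int p * k'" "l = int p * l'" by (auto elim!: dvdE)
    then have "g = (a [^] p) [^] k' \<otimes> (b [^] p) [^] l' \<otimes> n"
      unfolding gf by (simp add: int_pow_pow flip: int_pow_int)
    then have "g \<in> N"
      using n apN bpN by (simp add: subgroup.m_closed[OF Nsub] subgroup_int_pow_closed[OF Nsub])
    then show "g \<in> {\<one>}" using g NR by blast
  qed
  have gen: "carrier G \<subseteq> P.span N <#> R\<^sub>3"
  proof
    fix g assume "g \<in> carrier G"
    then obtain k l z where g: "g = a [^] (k::int) \<otimes> b [^] (l::int) \<otimes> z" and z: "z \<in> ?C"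
      using P.carrier_span by blast
    obtain q r\<^sub>1 where r1: "z = t [^] (q::int) \<otimes> r\<^sub>1" "r\<^sub>1 \<in> R\<^sub>1"
      using z S1 unfolding splits_def by blast
    obtain q' r\<^sub>2 where r2: "r\<^sub>1 = z\<^sub>2 [^] (q'::int) \<otimes> r\<^sub>2" "r\<^sub>2 \<in> R\<^sub>2"
      using r1(2) S2 unfolding splits_def by blast
    obtain q'' r\<^sub>3 where r3: "r\<^sub>2 = z\<^sub>3 [^] (q''::int) \<otimes> r\<^sub>3" "r\<^sub>3 \<in> R\<^sub>3"
      using r2(2) S3 unfolding splits_def by blast
    have r3c: "r\<^sub>3 \<in> carrier G" using subgroup.mem_carrier[OF sub(3) r3(2)] .
    let ?n = "t [^] q \<otimes> (z\<^sub>2 [^] q' \<otimes> z\<^sub>3 [^] q'')"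
    have "g = (a [^] k \<otimes> b [^] l \<otimes> ?n) \<otimes> r\<^sub>3"
      unfolding g r1 r2 r3 using car r3c by (simp add: m_assoc)
    moreover have "a [^] k \<otimes> b [^] l \<otimes> ?n \<in> P.span N" unfolding P.span_def using NI by blast
    ultimately show "g \<in> P.span N <#> R\<^sub>3" using r3(2) unfolding set_mult_def by blast
  qed
  have "internal_direct_product G (P.span N) R\<^sub>3"
    using RC by (intro internal_direct_productI_central Dsub sub(3) int gen) auto
  then have "P.span N = {\<one>} \<or> R\<^sub>3 = {\<one>}"
    using indec unfolding indecomposable_group_def by blast
  \<comment> \<open>\<open>span N\<close> contains the nontrivial element \<open>c\<close>, so
    indecomposability can only make \<open>R\<^sub>3\<close> trivial.\<close>
  moreover have "P.span N \<noteq> {\<one>}"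
    using P.span_contains(3)[OF Nsub] cN P.c_ne_one by blast
  ultimately have R3: "R\<^sub>3 = {\<one>}" by blast
  have "direct_product_of_three_cyclic ?Z t z\<^sub>2 z\<^sub>3"
    using Z.splits_direct_product_of_three_cyclic[of t R\<^sub>1 z\<^sub>2 R\<^sub>2 z\<^sub>3] t(1) z2(1) z3(1) R3 by simp
  moreover have "a [^] p \<in> generate G {t} <#> generate G {z\<^sub>2}"
    unfolding ap generate_pow[OF car(1)] generate_pow[OF car(2)] set_mult_def by blast
  moreover have "inv a \<otimes> inv b \<otimes> a \<otimes> b = t [^] (p ^ m)" using Pc t(4) by (simp add: P.c_def)
  ultimately show ?thesis using pair t(3) z2(3) z3(2) by blast
qed

end

section \<open>The two implications\<close>

lemma (in group) quotient_iso_imp_decomposition: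
  assumes "prime p" "finitely_generated_group G"
    "G Mod group_center G \<cong> integer_mod_group p \<times>\<times> integer_mod_group p"
  shows "\<exists>D A. internal_direct_product G D A \<and>
       comm_group (G\<lparr>carrier := A\<rparr>) \<and> finitely_generated_group (G\<lparr>carrier := A\<rparr>) \<and>
       indecomposable_group (G\<lparr>carrier := D\<rparr>) \<and>
       (\<exists>x\<in>D. \<exists>y\<in>D. \<exists>t\<^sub>1 z\<^sub>2 z\<^sub>3.
          let Z = group_center (G\<lparr>carrier := D\<rparr>) in
          D = generate G ({x, y} \<union> Z) \<and>
          direct_product_of_three_cyclic (G\<lparr>carrier := Z\<rparr>) t\<^sub>1 z\<^sub>2 z\<^sub>3 \<and>
          (\<exists>m\<^sub>1::nat. m\<^sub>1 \<ge> 1 \<and> ord t\<^sub>1 = p ^ m\<^sub>1 \<and>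
             inv x \<otimes> inv y \<otimes> x \<otimes> y = t\<^sub>1 [^] (p ^ (m\<^sub>1 - 1))) \<and>
          p_power_or_infinite_order G p z\<^sub>2 \<and> p_power_or_infinite_order G p z\<^sub>3 \<and>
          x [^] p \<in> Z \<and> y [^] p \<in> Z \<and>
          x [^] p \<in> generate G {t\<^sub>1} <#> generate G {z\<^sub>2})"
proof -
  obtain x y where "center_quotient_pair G x y p"
    using center_quotient_pairI[OF assms(1,3)] by blast
  then interpret X: center_quotient_pair G x y p .
  obtain D A where DA: "internal_direct_product G D A" and AZ: "A \<subseteq> group_center G"
    and indec: "indecomposable_group (G\<lparr>carrier := D\<rparr>)"
    using X.exists_indecomposable_factor[OF assms(2)] by blast
  have Asub: "subgroup A G" and Dsub: "subgroup D G" and gen: "D <#> A = carrier G"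
    using DA by (auto simp: internal_direct_product_def normal_imp_subgroup)
  let ?D = "G\<lparr>carrier := D\<rparr>"
  let ?Z = "group_center ?D"
  have Zeq: "?Z = D \<inter> group_center G" by (rule group_center_factor[OF DA])
  have A_comm: "comm_group (G\<lparr>carrier := A\<rparr>)"
    by (rule group.group_comm_groupI[OF subgroup_imp_group[OF Asub]])
      (use AZ group_centerD subgroup.mem_carrier[OF Asub] in auto)
  have fg_sub: "finitely_generated_group (G\<lparr>carrier := H\<rparr>)"
    if H: "subgroup H G" and T: "finite T" "T \<subseteq> H" "generate G T = H" for H T
    unfolding finitely_generated_group_def
    using subgroup_imp_group[OF H] T generate_consistent[OF T(2) H] by auto
  obtain T where T: "finite T" "T \<subseteq> A" "generate G T = A"
    using X.central_subgroup_finitely_generated[OF assms(2) Asub AZ] by blast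
  have A_fg: "finitely_generated_group (G\<lparr>carrier := A\<rparr>)" by (rule fg_sub[OF Asub T])
  \<comment> \<open>\<open>D\<close> was found without regard to \<open>x\<close> and
    \<open>y\<close>. Dropping their components in the central factor \<open>A\<close> moves them
    into \<open>D\<close>.\<close>
  obtain x' u where x': "x = x' \<otimes> u" "x' \<in> D" "u \<in> A"
    using X.xy(1) gen unfolding set_mult_def by blast
  obtain y' v where y': "y = y' \<otimes> v" "y' \<in> D" "v \<in> A"
    using X.xy(2) gen unfolding set_mult_def by blast
  have uv: "u \<in> carrier G" "v \<in> carrier G" "x' \<in> carrier G" "y' \<in> carrier G"
    using x' y' subgroup.mem_carrier[OF Asub] subgroup.mem_carrier[OF Dsub] by auto
  have "inv u \<in> group_center G" "inv v \<in> group_center G"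
    using x'(3) y'(3) AZ subgroup.m_inv_closed[OF group_center_subgroup] by auto
  from X.center_shift(1)[OF this] have "center_quotient_pair G x' y' p"
    unfolding x' y' using uv by (simp add: m_assoc)
  then interpret Y: center_quotient_pair G x' y' p .
  have "center_quotient_pair ?D x' y' p"
    by (rule Y.restrict_subgroup[OF Dsub x'(2) y'(2) Zeq])
  then interpret D: center_quotient_pair ?D x' y' p .
  have Zsub: "subgroup ?Z G" by (rule incl_subgroup[OF Dsub D.group_center_subgroup])
  have ZD: "?Z \<subseteq> D" using Zeq by blast
  \<comment> \<open>The structure of the indecomposable factor is derived inside \<open>D\<close>,
    which must itself be finitely generated for this: \<open>x'\<close>, \<open>y'\<close> and
    generators of its center suffice.\<close>
  have D_fg: "finitely_generated_group ?D"
  proof -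
    obtain S where S: "finite S" "S \<subseteq> ?Z" "generate G S = ?Z"
      using X.central_subgroup_finitely_generated[OF assms(2) Zsub] Zeq by blast
    let ?T = "{x', y'} \<union> S"
    define H where "H = generate G ?T"
    have T: "?T \<subseteq> D" using S(2) ZD x'(2) y'(2) by auto
    have H: "subgroup H G" unfolding H_def
      using T subgroup.subset[OF Dsub] by (intro generate_is_subgroup) blast
    have xyH: "x' \<in> H" "y' \<in> H" unfolding H_def by (auto intro: generate.incl)
    have "S \<subseteq> H" unfolding H_def by (auto intro: generate.incl)
    then have ZH: "?Z \<subseteq> H" using generate_subgroup_incl[OF _ H] S(3) by blast
    have pw: "x' [^]\<^bsub>?D\<^esub> (i::int) = x' [^] i" "y' [^]\<^bsub>?D\<^esub> (i::int) = y' [^] i" for i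
      using int_pow_consistent[OF Dsub x'(2)] int_pow_consistent[OF Dsub y'(2)] by simp_all
    have Dspan: "D = {x' [^] (i::int) \<otimes> y' [^] (j::int) \<otimes> z | i j z. z \<in> ?Z}"
      using D.carrier_span unfolding pw by simp
    have "D \<subseteq> H"
    proof
      fix g assume "g \<in> D"
      then obtain i j z where "g = x' [^] (i::int) \<otimes> y' [^] (j::int) \<otimes> z" "z \<in> ?Z"
        using Dspan by blast
      then show "g \<in> H"
        using xyH ZH by (auto intro!: subgroup.m_closed[OF H] subgroup_int_pow_closed[OF H])
    qed
    moreover have "H \<subseteq> D" unfolding H_def by (rule generate_subgroup_incl[OF T Dsub])
    ultimately have "generate G ?T = D" by (simp add: H_def)
    then show ?thesis using S(1) T by (intro fg_sub[OF Dsub, of ?T]) auto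
  qed
  have ordD: "D.ord z = ord z" for z by (rule ord_consistent[OF Dsub])
  have powD: "z [^]\<^bsub>?D\<^esub> (n::nat) = z [^] n" for z n using nat_pow_consistent by metis
  have ptypeD: "p_power_or_infinite_order ?D p z = p_power_or_infinite_order G p z" for z
    by (simp add: p_power_or_infinite_order_def ordD)
  obtain a b t z\<^sub>2 z\<^sub>3 m where ab: "center_quotient_pair ?D a b p"
    and three: "direct_product_of_three_cyclic (?D\<lparr>carrier := ?Z\<rparr>) t z\<^sub>2 z\<^sub>3"
    and t: "ord t = p ^ Suc m"
    and comm: "inv\<^bsub>?D\<^esub> a \<otimes> inv\<^bsub>?D\<^esub> b \<otimes> a \<otimes> b = t [^] (p ^ m)"
    and z: "p_power_or_infinite_order G p z\<^sub>2" "p_power_or_infinite_order G p z\<^sub>3"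
    and ap: "a [^] p \<in> generate ?D {t} <#> generate ?D {z\<^sub>2}"
    using D.indecomposable_structure[OF D_fg indec] unfolding ordD powD ptypeD by auto
  interpret E: center_quotient_pair ?D a b p by (rule ab)
  have abD: "a \<in> D" "b \<in> D" using E.xy by simp_all
  have tz: "t \<in> ?Z" "z\<^sub>2 \<in> ?Z" using three by (auto simp: direct_product_of_three_cyclic_def)
  have "{a, b} \<union> ?Z \<subseteq> D" using abD ZD by blast
  then have "generate ?D ({a, b} \<union> ?Z) = generate G ({a, b} \<union> ?Z)"
    by (rule generate_consistent[OF _ Dsub])
  then have gD: "D = generate G ({a, b} \<union> ?Z)"
    using E.span_eq_generate[OF D.group_center_subgroup subset_refl E.c_center] E.carrier_span
    by (simp add: E.span_def)
  have three': "direct_product_of_three_cyclic (G\<lparr>carrier := ?Z\<rparr>) t z\<^sub>2 z\<^sub>3" using three by simp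
  have comm': "inv a \<otimes> inv b \<otimes> a \<otimes> b = t [^] (p ^ m)" using comm abD Dsub by simp
  have "generate ?D {t} = generate G {t}" "generate ?D {z\<^sub>2} = generate G {z\<^sub>2}"
    using tz ZD by (auto intro!: generate_consistent Dsub)
  then have ap': "a [^] p \<in> generate G {t} <#> generate G {z\<^sub>2}" using ap by simp
  have pw: "a [^] p \<in> ?Z" "b [^] p \<in> ?Z" using E.pow_central by (simp_all add: powD)
  \<comment> \<open>Orders were written as \<open>p^(m+1)\<close>, so \<open>m\<close> is the
    required \<open>m\<^sub>1 - 1\<close> and \<open>m\<^sub>1 \<ge> 1\<close> is automatic.\<close>
  have "\<exists>m\<^sub>1::nat. m\<^sub>1 \<ge> 1 \<and> ord t = p ^ m\<^sub>1 \<and> inv a \<otimes> inv b \<otimes> a \<otimes> b = t [^] (p ^ (m\<^sub>1 - 1))"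
    using t comm' by (intro exI[of _ "Suc m"]) simp
  then have "let Z = group_center ?D in
      D = generate G ({a, b} \<union> Z) \<and>
      direct_product_of_three_cyclic (G\<lparr>carrier := Z\<rparr>) t z\<^sub>2 z\<^sub>3 \<and>
      (\<exists>m\<^sub>1::nat. m\<^sub>1 \<ge> 1 \<and> ord t = p ^ m\<^sub>1 \<and>
         inv a \<otimes> inv b \<otimes> a \<otimes> b = t [^] (p ^ (m\<^sub>1 - 1))) \<and>
      p_power_or_infinite_order G p z\<^sub>2 \<and> p_power_or_infinite_order G p z\<^sub>3 \<and>
      a [^] p \<in> Z \<and> b [^] p \<in> Z \<and>
      a [^] p \<in> generate G {t} <#> generate G {z\<^sub>2}"
    unfolding Let_def using gD three' z ap' pw by (intro conjI)
  then show ?thesis using DA A_comm A_fg indec abD by blast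
qed

text \<open>The pair \<open>x\<close>, \<open>y\<close> of \<open>D\<close> also serves for
  \<open>G\<close>: the abelian factor \<open>A\<close> commutes with itself and with
  \<open>D\<close>, so \<open>A\<close> and \<open>Z\<close> lie in the center of \<open>G\<close>,
  and over that center \<open>x\<close> and \<open>y\<close> span everything. The commutator is
  nontrivial because \<open>p^(m-1)\<close> is smaller than the order \<open>p^m\<close> of
  \<open>t\<close>.\<close>

lemma (in group) decomposition_imp_quotient_iso:
  assumes "prime p" and DA: "internal_direct_product G D A" and A: "comm_group (G\<lparr>carrier := A\<rparr>)"
    and xy: "x \<in> D" "y \<in> D"
    and Z: "Z = group_center (G\<lparr>carrier := D\<rparr>)"
    and gen: "D = generate G ({x, y} \<union> Z)"
    and t: "t \<in> Z" "ord t = p ^ m" "m \<ge> 1"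
    and comm: "inv x \<otimes> inv y \<otimes> x \<otimes> y = t [^] (p ^ (m - 1))"
    and pow: "x [^] p \<in> Z" "y [^] p \<in> Z"
  shows "G Mod group_center G \<cong> integer_mod_group p \<times>\<times> integer_mod_group p"
proof -
  let ?C = "group_center G"
  have Dn: "D \<lhd> G" and An: "A \<lhd> G" and int: "D \<inter> A = {\<one>}" and DAG: "D <#> A = carrier G"
    using DA by (auto simp: internal_direct_product_def)
  have Dsub: "subgroup D G" and Asub: "subgroup A G" using Dn An by (simp_all add: normal_imp_subgroup)
  have ZC: "Z \<subseteq> ?C" using group_center_factor[OF DA] Z by blast
  have AC: "A \<subseteq> ?C"
  proof
    fix a assume a: "a \<in> A"
    interpret A: comm_group "G\<lparr>carrier := A\<rparr>" by (rule A)
    have ac: "a \<in> carrier G" using subgroup.mem_carrier[OF Asub a] .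
    show "a \<in> ?C" unfolding group_center_def
    proof (safe intro!: ac)
      fix g assume "g \<in> carrier G"
      then obtain d a' where g: "g = d \<otimes> a'" and d: "d \<in> D" and a': "a' \<in> A"
        using DAG unfolding set_mult_def by blast
      have C: "d \<in> carrier G" "a' \<in> carrier G"
        using d a' subgroup.mem_carrier[OF Asub] subgroup.mem_carrier[OF Dsub] by auto
      have "a \<otimes> g = d \<otimes> a \<otimes> a'"
        unfolding g using commute_of_normal[OF Dn An int d a] C ac by (simp flip: m_assoc)
      also have "\<dots> = d \<otimes> (a' \<otimes> a)" using A.m_comm a a' C ac by (simp add: m_assoc)
      finally show "a \<otimes> g = g \<otimes> a" unfolding g using C ac by (simp add: m_assoc)
    qed
  qed
  have xyc: "x \<in> carrier G" "y \<in> carrier G" using xy subgroup.mem_carrier[OF Dsub] by auto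
  have tc: "t \<in> ?C" "t \<in> carrier G" using t(1) ZC group_centerD(1) by auto
  have cC: "inv x \<otimes> inv y \<otimes> x \<otimes> y \<in> ?C"
    unfolding comm using subgroup_int_pow_closed[OF group_center_subgroup tc(1)] by (metis int_pow_int)
  interpret X: central_commutator G x y using xyc cC by unfold_locales
  have span: "subgroup (X.span ?C) G"
    by (rule X.span_subgroup[OF group_center_subgroup subset_refl X.c_center])
  note sc = X.span_contains[OF group_center_subgroup]
  have "D \<subseteq> X.span ?C" unfolding gen using sc ZC by (intro generate_subgroup_incl span) auto
  moreover have "A \<subseteq> X.span ?C" using AC sc(3) by blast
  ultimately have "carrier G \<subseteq> X.span ?C"
    unfolding DAG[symmetric] set_mult_def using subgroup.m_closed[OF span] by blast
  then have full: "carrier G = X.span ?C" using subgroup.subset[OF span] by blast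
  have ne: "inv x \<otimes> inv y \<otimes> x \<otimes> y \<noteq> \<one>"
  proof
    assume "inv x \<otimes> inv y \<otimes> x \<otimes> y = \<one>"
    then have "p ^ m dvd p ^ (m - 1)" using comm tc(2) t(2) by (simp add: pow_eq_id)
    then have "m \<le> m - 1" using assms(1) prime_gt_1_nat power_dvd_imp_le by blast
    then show False using t(3) by simp
  qed
  interpret P: center_quotient_pair G x y p
    using assms(1) ne pow ZC full by unfold_locales (auto simp: X.span_def)
  show ?thesis by (rule P.quotient_iso)
qed

theorem theorem2p1:
  fixes G :: "('a, 'b) monoid_scheme" (structure) and p :: nat
  assumes "prime p" and "group G" and "finitely_generated_group G"
  shows "G Mod group_center G \<cong> integer_mod_group p \<times>\<times> integer_mod_group p \<longleftrightarrow>
    (\<exists>D A. internal_direct_product G D A \<and>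
       comm_group (G\<lparr>carrier := A\<rparr>) \<and> finitely_generated_group (G\<lparr>carrier := A\<rparr>) \<and>
       indecomposable_group (G\<lparr>carrier := D\<rparr>) \<and>
       (\<exists>x\<in>D. \<exists>y\<in>D. \<exists>t\<^sub>1 z\<^sub>2 z\<^sub>3.
          let Z = group_center (G\<lparr>carrier := D\<rparr>) in
          D = generate G ({x, y} \<union> Z) \<and>
          direct_product_of_three_cyclic (G\<lparr>carrier := Z\<rparr>) t\<^sub>1 z\<^sub>2 z\<^sub>3 \<and>
          (\<exists>m\<^sub>1::nat. m\<^sub>1 \<ge> 1 \<and> group.ord G t\<^sub>1 = p ^ m\<^sub>1 \<and>
             inv x \<otimes> inv y \<otimes> x \<otimes> y = t\<^sub>1 [^] (p ^ (m\<^sub>1 - 1))) \<and>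
          p_power_or_infinite_order G p z\<^sub>2 \<and> p_power_or_infinite_order G p z\<^sub>3 \<and>
          x [^] p \<in> Z \<and> y [^] p \<in> Z \<and>
          x [^] p \<in> generate G {t\<^sub>1} <#> generate G {z\<^sub>2}))"
  (is "?L \<longleftrightarrow> ?R")
proof -
  interpret group G by fact
  show ?thesis
  proof
    show "?L \<Longrightarrow> ?R" by (rule quotient_iso_imp_decomposition[OF assms(1,3)])
  next
    assume ?R
    then obtain D A x y t z\<^sub>2 z\<^sub>3 m where
      DA: "internal_direct_product G D A" "comm_group (G\<lparr>carrier := A\<rparr>)" and xy: "x \<in> D" "y \<in> D"
      and gen: "D = generate G ({x, y} \<union> group_center (G\<lparr>carrier := D\<rparr>))"
      and t: "direct_product_of_three_cyclic (G\<lparr>carrier := group_center (G\<lparr>carrier := D\<rparr>)\<rparr>) t z\<^sub>2 z\<^sub>3"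
      and m: "m \<ge> 1" "ord t = p ^ m" "inv x \<otimes> inv y \<otimes> x \<otimes> y = t [^] (p ^ (m - 1))"
      and pow: "x [^] p \<in> group_center (G\<lparr>carrier := D\<rparr>)" "y [^] p \<in> group_center (G\<lparr>carrier := D\<rparr>)"
      unfolding Let_def by blast
    have "t \<in> group_center (G\<lparr>carrier := D\<rparr>)" using t by (simp add: direct_product_of_three_cyclic_def)
    then show ?L
      by (rule decomposition_imp_quotient_iso[OF assms(1) DA xy refl gen _ m(2,1,3) pow])
  qed
qed

end
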